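(* Let $X=(X_t)_{t\ge 0}$ be a real-valued (one-dimensional) Lévy process with $X_0=0$ almost surely, $\mathbb{E}[X_1]=0$ and $\sigma:=\mathbb{E}[X_1^2]^{1/2}\in(0,\infty)$. Then the following two conditions are equivalent: (i) $$\int_1^\infty \sup_{x\in\mathbb{R}}\left|\mathbb{P}\left(\frac{X_t}{\sqrt{t}}\le x\right)-\Phi\left(\frac{x}{\sigma}\right)\right|\frac{\mathrm{d}t}{t}<\infty ;$$ (ii) $$\mathbb{E}\left[X_1^2\max\{0,\log|X_1|\}\right]<\infty .$$
   Context: $\Phi$ denotes the distribution function of a standard normal random variable: $\Phi(x)=\int_{-\infty}^x \frac{1}{\sqrt{2\pi}}e^{-u^2/2}\,\mathrm{d}u$. The quantity $X_1^2\max\{0,\log|X_1|\}$ is understood to be $0$ when $X_1=0$. *)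

theory Defs
  imports "HOL-Probability.Probability"
begin

text \<open>
  A real-valued Levy process with time set \<open>[0, \<infinity>)\<close>; only the values \<open>X t\<close> with
  \<open>t \<ge> 0\<close> matter. The family \<open>t\<close> in \<open>independent_increments\<close> encodes a finite chain
  \<open>0 \<le> t 0 < \<dots> < t n\<close>; its values beyond \<open>n\<close> are irrelevant.
\<close>

locale levy_process = prob_space M for M :: "'a measure" +
  fixes X :: "real \<Rightarrow> 'a \<Rightarrow> real"
  assumes random_variable: "\<And>t. 0 \<le> t \<Longrightarrow> random_variable borel (X t)"
    and start_zero: "AE \<omega> in M. X 0 \<omega> = 0"
    and independent_increments:
      "\<And>(n::nat) t. 0 \<le> t 0 \<Longrightarrow> (\<And>i. i < n \<Longrightarrow> t i < t (Suc i)) \<Longrightarrow>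
         indep_vars (\<lambda>_. borel) (\<lambda>i \<omega>. X (t (Suc i)) \<omega> - X (t i) \<omega>) {..<n}"
    and stationary_increments:
      "\<And>s h. 0 \<le> s \<Longrightarrow> 0 \<le> h \<Longrightarrow>
         distr M borel (\<lambda>\<omega>. X (s + h) \<omega> - X s \<omega>) = distr M borel (\<lambda>\<omega>. X h \<omega> - X 0 \<omega>)"
    and stochastically_continuous:
      "\<And>t \<epsilon>. 0 \<le> t \<Longrightarrow> 0 < \<epsilon> \<Longrightarrow>
         ((\<lambda>s. prob {\<omega> \<in> space M. \<bar>X s \<omega> - X t \<omega>\<bar> > \<epsilon>}) \<longlongrightarrow> 0) (at t within {0..})"
    and cadlag_paths:
      "AE \<omega> in M. (\<forall>t\<ge>0. continuous (at_right t) (\<lambda>s. X s \<omega>)) \<and>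
                  (\<forall>t>0. \<exists>l. ((\<lambda>s. X s \<omega>) \<longlongrightarrow> l) (at_left t))"

definition std_normal_cdf :: "real \<Rightarrow> real" where
  "std_normal_cdf x = (LBINT u:{..x}. 1 / sqrt (2 * pi) * exp (- u\<^sup>2 / 2))"

lemma std_normal_cdf_eq_cdf: "std_normal_cdf x = cdf std_normal_distribution x"
proof -
  have "integrable lborel (\<lambda>u. indicator {..x} u *\<^sub>R std_normal_density u)"
    by (intro integrable_mult_indicator) auto
  then have "measure std_normal_distribution {..x} = (LBINT u:{..x}. std_normal_density u)"
    unfolding set_lebesgue_integral_def measure_def
    by (subst emeasure_density) (auto simp: nn_integral_eq_integral[symmetric] integral_eq_nn_integral
        intro!: arg_cong[where f = enn2real] nn_integral_cong split: split_indicator)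
  then show ?thesis
    by (simp add: std_normal_cdf_def cdf_def std_normal_density_def)
qed

end

theory Submission
  imports Defs
begin

text \<open>
  Write \<open>\<phi>\<^sub>t\<close> for the characteristic function of \<open>X t\<close>. Independent stationary increments give
  \<open>\<phi>\<^sub>t = \<phi>\<^sub>1 ^ n * \<phi>\<^sub>s\<close> with \<open>n = \<lfloor>t\<rfloor>\<close> and \<open>s = t - n\<close>, so the law of \<open>X t / (\<sigma> * sqrt t)\<close> differs from that
  of a normalised random walk only by the harmless factor \<open>\<phi>\<^sub>s\<close>. Both implications compare \<open>\<phi>\<^sub>1(w)\<close>
  with its quadratic approximation at the scale
  \<open>w = u / (\<sigma> * sqrt t)\<close>. The error at that scale, integrated against \<open>dt / t\<close>, is where the logarithm
  comes from: relative to \<open>w\<^sup>2\<close>, the part of it produced by a value \<open>x\<close> of \<open>X 1\<close> is of order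
  \<open>x\<^sup>2 * min 1 (\<bar>w * x\<bar>)\<close> at most, and of order \<open>x\<^sup>2\<close> as long as \<open>t\<close> is small compared with \<open>(u * x)\<^sup>2\<close>; and
  \<open>\<integral> x\<^sup>2 * min 1 (\<bar>u * x\<bar> / sqrt t) dt / t\<close> over \<open>t \<ge> 1\<close> is of order \<open>x\<^sup>2 * ln \<bar>x\<bar>\<close>.

  From the log moment to the integral: the supremum is bounded by an integral of
  \<open>\<bar>char - exp (- u\<^sup>2 / 2)\<bar> / \<bar>u\<bar>\<close> against a Gaussian weight of width \<open>1 / h\<close>, plus a multiple of \<open>h\<close>
  (\<open>Gaussian_Esseen_inequality\<close>, from Levy's inversion formula). There is ample room in the choice of \<open>h\<close>:
  for \<open>h = t powr (-1/4)\<close> the term \<open>h\<close> is integrable against \<open>dt / t\<close>, and so is the contribution of the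
  frequencies \<open>\<bar>w\<bar> > \<epsilon>\<close>, where nothing is known about the characteristic function. For \<open>\<bar>w\<bar> \<le> \<epsilon>\<close> the factor
  \<open>\<phi>\<^sub>1 ^ n\<close> has Gaussian decay (\<open>char_scaled_law_approx\<close>), and Tonelli's theorem leaves the logarithmic
  integral above (\<open>nn_integral_lindeberg_moment_le\<close>).

  From the integral to the log moment: the Kolmogorov distance controls expectations of test functions of
  bounded variation, to which \<open>x \<mapsto> exp (\<i> * u * x)\<close> does not belong. The Gaussian density does, and
  by Parseval's formula it turns expectations into Gaussian averages of characteristic functions. Applied to
  the symmetrised law this gives that the Gaussian average of \<open>\<bar>char\<bar>\<^sup>2 - exp (- z\<^sup>2)\<close> is at most
  six times the Kolmogorov distance (\<open>expectation_norm_char_sq_le\<close>). Now \<open>\<bar>\<phi>\<^sub>1(w)\<bar>\<^sup>2\<close> is the real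
  characteristic function of the difference of two independent copies of \<open>X 1\<close>, and it exceeds its quadratic
  approximation by a nonnegative amount, the expectation of \<open>cos - 1 + x\<^sup>2 / 2\<close>; the tangent inequality for
  powers keeps this amount, up to a term that is integrable against \<open>dt / t\<close>
  (\<open>cmod_char_scaled_law_ge\<close>). By Tonelli's theorem the excess integrates to at least the log moment of the
  difference, and fixing a value of one of the two copies gives that of \<open>X 1\<close>.
\<close>

section \<open>Distribution functions and characteristic functions\<close>

lemma cmod_iexp_diff_quotient_le:
  fixes a b t :: real
  shows "cmod ((iexp (-(t * a)) - iexp (-(t * b))) / (\<i> * t)) \<le> 2 / \<bar>t\<bar>"
proof -
  have "cmod (iexp (-(t * a)) - iexp (-(t * b))) \<le> 1 + 1"
    by (rule order_trans[OF norm_triangle_ineq4]) (metis norm_exp_i_times order_refl)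
  then show ?thesis
    by (simp add: norm_divide norm_mult divide_right_mono)
qed

text \<open>
  Subtract the inversion formulas of the two laws and bound the kernel by \<open>2 / \<bar>t\<bar>\<close>. In this way only
  the difference of the characteristic functions, which vanishes at \<open>0\<close>, is divided by \<open>\<bar>t\<bar>\<close>.
\<close>

lemma abs_cdf_increment_diff_le_char:
  fixes a b B :: real
  assumes "real_distribution M1" "real_distribution M2" "a \<le> b"
    and a: "measure M1 {a} = 0" "measure M2 {a} = 0"
    and b: "measure M1 {b} = 0" "measure M2 {b} = 0"
    and B: "(\<integral>\<^sup>+u. ennreal (cmod (char M1 u - char M2 u) / \<bar>u\<bar>) \<partial>lborel) = ennreal B" "0 \<le> B"
  shows "\<bar>measure M1 {a<..b} - measure M2 {a<..b}\<bar> \<le> B"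
proof -
  interpret M1: real_distribution M1 by (rule assms)
  interpret M2: real_distribution M2 by (rule assms)
  let ?k = "\<lambda>t::real. (iexp (-(t * a)) - iexp (-(t * b))) / (\<i> * t)"
  let ?I = "\<lambda>M. \<lambda>T::nat. 1 / (2 * pi) * (CLBINT t=-T..T. ?k t * char M t)"
  have intg: "set_integrable lborel {-real T<..<real T} (\<lambda>t. ?k t * char M t)"
    if "real_distribution M" for M and T :: nat
    unfolding set_integrable_def
  proof (rule integrableI_bounded_set_indicator[where B="b - a"])
    interpret real_distribution M by (rule that)
    show "AE x \<in> {- real T<..<real T} in lborel. cmod (?k x * char M x) \<le> b - a"
    proof (rule AE_mp[OF AE_lborel_singleton[of 0]], intro AE_I2 impI)
      fix x :: real assume "x \<noteq> 0"
      then have 1: "cmod (?k x) \<le> b - a"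
        using Levy_Inversion_aux2[of "-b" "-a" x] \<open>a \<le> b\<close> by simp
      show "cmod (?k x * char M x) \<le> b - a"
        unfolding norm_mult using mult_mono[OF 1 cmod_char_le_1[of x]] \<open>a \<le> b\<close> by simp
    qed
    show "(\<lambda>t. ?k t * char M t) \<in> borel_measurable lborel"
      using char_measurable by simp
  qed auto
  have bound: "cmod (?I M1 T - ?I M2 T) \<le> B" for T :: nat
  proof -
    have "(CLBINT t=-T..T. ?k t * char M1 t) - (CLBINT t=-T..T. ?k t * char M2 t)
       = (CLBINT t:{-real T<..<real T}. ?k t * char M1 t) - (CLBINT t:{-real T<..<real T}. ?k t * char M2 t)"
      by (simp add: interval_lebesgue_integral_def)
    also have "\<dots> = (CLBINT t:{-real T<..<real T}. ?k t * char M1 t - ?k t * char M2 t)"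
      by (rule set_integral_diff(2)[OF intg[OF assms(1)] intg[OF assms(2)], symmetric])
    also have "\<dots> = (CLBINT t:{-real T<..<real T}. ?k t * (char M1 t - char M2 t))"
      by (simp only: right_diff_distrib)
    finally have eq: "(CLBINT t=-T..T. ?k t * char M1 t) - (CLBINT t=-T..T. ?k t * char M2 t) = \<dots>" .
    have "ennreal (cmod (CLBINT t:{-real T<..<real T}. ?k t * (char M1 t - char M2 t)))
       \<le> (\<integral>\<^sup>+t. norm (indicator {-real T<..<real T} t *\<^sub>R (?k t * (char M1 t - char M2 t))) \<partial>lborel)"
      unfolding set_lebesgue_integral_def
      by (rule integral_norm_bound_ennreal)
         (use set_integral_diff(1)[OF intg[OF assms(1)] intg[OF assms(2)], of T] in
           \<open>simp add: set_integrable_def right_diff_distrib\<close>)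
    also have "\<dots> \<le> (\<integral>\<^sup>+t. 2 * ennreal (cmod (char M1 t - char M2 t) / \<bar>t\<bar>) \<partial>lborel)"
    proof (rule nn_integral_mono)
      fix t :: real
      have "norm (indicator {-real T<..<real T} t *\<^sub>R (?k t * (char M1 t - char M2 t)))
         \<le> cmod (?k t) * cmod (char M1 t - char M2 t)"
        unfolding norm_scaleR norm_mult by (rule mult_left_le_one_le) (auto simp: indicator_def)
      also have "\<dots> \<le> 2 / \<bar>t\<bar> * cmod (char M1 t - char M2 t)"
        by (intro mult_right_mono cmod_iexp_diff_quotient_le) simp
      also have "\<dots> = 2 * (cmod (char M1 t - char M2 t) / \<bar>t\<bar>)" by simp
      finally show "ennreal (norm (indicator {-real T<..<real T} t *\<^sub>R (?k t * (char M1 t - char M2 t))))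
         \<le> 2 * ennreal (cmod (char M1 t - char M2 t) / \<bar>t\<bar>)"
        by (metis ennreal_leI ennreal_mult' ennreal_numeral norm_ge_zero zero_le_numeral)
    qed
    also have "\<dots> = 2 * ennreal B"
      using B(1) by (subst nn_integral_cmult) auto
    also have "\<dots> = ennreal (2 * B)"
      by (simp add: ennreal_mult')
    finally have 2: "cmod (CLBINT t:{-real T<..<real T}. ?k t * (char M1 t - char M2 t)) \<le> 2 * B"
      using B(2) by simp
    have "cmod (?I M1 T - ?I M2 T) = 1 / (2 * pi) * cmod (CLBINT t:{-real T<..<real T}. ?k t * (char M1 t - char M2 t))"
      unfolding right_diff_distrib[symmetric] norm_mult eq by (simp add: norm_divide norm_mult)
    also have "\<dots> \<le> 1 / (2 * pi) * (2 * B)"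
      by (intro mult_left_mono 2) simp
    also have "\<dots> \<le> B"
      using B(2) pi_ge_two mult_left_mono[of 1 pi B] by (simp add: field_simps)
    finally show ?thesis .
  qed
  have "?I M1 \<longlonglongrightarrow> measure M1 {a<..b}"
    by (rule M1.Levy_Inversion[OF \<open>a \<le> b\<close> a(1) b(1)])
  moreover have "?I M2 \<longlonglongrightarrow> measure M2 {a<..b}"
    by (rule M2.Levy_Inversion[OF \<open>a \<le> b\<close> a(2) b(2)])
  ultimately have "(\<lambda>T. cmod (?I M1 T - ?I M2 T)) \<longlonglongrightarrow> cmod (complex_of_real (measure M1 {a<..b}) - complex_of_real (measure M2 {a<..b}))"
    by (intro tendsto_norm tendsto_diff)
  from LIMSEQ_le_const2[OF this] bound
  have "cmod (complex_of_real (measure M1 {a<..b}) - measure M2 {a<..b}) \<le> B" by auto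
  then show ?thesis
    by (metis norm_of_real of_real_diff)
qed

text \<open>
  The inversion formula only sees endpoints without atoms. There are such points arbitrarily close to the
  right of \<open>x\<close>, where right continuity applies, and arbitrarily far to the left, where both distribution
  functions vanish in the limit.
\<close>

lemma abs_cdf_diff_le_char:
  assumes "real_distribution M1" "real_distribution M2"
  shows "ennreal \<bar>cdf M1 x - cdf M2 x\<bar> \<le> (\<integral>\<^sup>+u. ennreal (cmod (char M1 u - char M2 u) / \<bar>u\<bar>) \<partial>lborel)"
proof (cases "(\<integral>\<^sup>+u. ennreal (cmod (char M1 u - char M2 u) / \<bar>u\<bar>) \<partial>lborel)")
  case (real B)
  interpret M1: real_distribution M1 by (rule assms)
  interpret M2: real_distribution M2 by (rule assms)
  have "countable ({x. measure M1 {x} \<noteq> 0} \<union> {x. measure M2 {x} \<noteq> 0})"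
    by (intro countable_Un M2.countable_support M1.countable_support)
  then have count: "countable {x. measure M1 {x} \<noteq> 0 \<or> measure M2 {x} \<noteq> 0}"
    by (simp add: Un_def)
  let ?D = "\<lambda>x. cdf M1 x - cdf M2 x"
  have "\<bar>?D x\<bar> \<le> B + \<epsilon>" if "\<epsilon> > 0" for \<epsilon>
  proof -
    have "(?D \<longlongrightarrow> 0) at_bot"
      using M1.cdf_lim_at_bot M2.cdf_lim_at_bot by (intro tendsto_eq_intros) auto
    then have "eventually (\<lambda>y. \<bar>?D y\<bar> < \<epsilon> / 2 \<and> y \<le> x) at_bot"
      using \<open>\<epsilon> > 0\<close> by (simp only: tendsto_iff dist_real_def diff_0_right eventually_conj eventually_le_at_bot)
    then obtain N where "\<And>y. y \<le> N \<Longrightarrow> \<bar>?D y\<bar> < \<epsilon> / 2" "N \<le> x"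
      unfolding eventually_at_bot_linorder by auto
    with open_minus_countable[OF count, of "{..< N}"] obtain a where
      a: "measure M1 {a} = 0" "measure M2 {a} = 0" "a < N" "a \<le> x" "\<bar>?D a\<bar> < \<epsilon> / 2"
      by auto
    have "(?D \<longlongrightarrow> ?D x) (at_right x)"
      using M1.cdf_is_right_cont [of x] M2.cdf_is_right_cont [of x]
      by (intro tendsto_intros) (auto simp add: continuous_within)
    then have "eventually (\<lambda>y. \<bar>?D y - ?D x\<bar> < \<epsilon> / 2) (at_right x)"
      using \<open>\<epsilon> > 0\<close> by (simp only: tendsto_iff dist_real_def eventually_conj eventually_at_right_less)
    then obtain N' where "N' > x" "\<And>y. x < y \<Longrightarrow> y < N' \<Longrightarrow> \<bar>?D y - ?D x\<bar> < \<epsilon> / 2"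
      by (auto simp add: eventually_at_right[OF less_add_one])
    with open_minus_countable[OF count, of "{x <..< N'}"] obtain b where b: "x < b"
        "measure M1 {b} = 0" "measure M2 {b} = 0" "\<bar>?D b - ?D x\<bar> < \<epsilon> / 2"
      by (auto simp: abs_minus_commute)
    have "a < b" using a(4) b(1) by simp
    have "\<bar>measure M1 {a<..b} - measure M2 {a<..b}\<bar> \<le> B"
      using \<open>a < b\<close> real by (intro abs_cdf_increment_diff_le_char assms a b) auto
    then show ?thesis
      using a(5) b(4) unfolding M1.cdf_diff_eq[OF \<open>a < b\<close>, symmetric] M2.cdf_diff_eq[OF \<open>a < b\<close>, symmetric]
      by linarith
  qed
  then have "\<bar>?D x\<bar> \<le> B" by (rule field_le_epsilon)
  then show ?thesis using real by simp
qed simp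

section \<open>Gaussian smoothing\<close>

lemma (in finite_borel_measure) borel_measurable_cdf [measurable]: "cdf M \<in> borel_measurable borel"
  by (intro borel_measurable_mono monoI cdf_nondecreasing)

definition gaussian_smoothing :: "real \<Rightarrow> real measure \<Rightarrow> real measure" where
  "gaussian_smoothing h M = distr (M \<Otimes>\<^sub>M std_normal_distribution) borel (\<lambda>(x, z). x + h * z)"

context real_distribution
begin

interpretation N: real_distribution std_normal_distribution
  by (rule real_dist_normal_dist)

interpretation P: pair_prob_space M std_normal_distribution ..

lemma real_distribution_gaussian_smoothing: "real_distribution (gaussian_smoothing h M)"
  unfolding gaussian_smoothing_def by (intro P.real_distribution_distr) simp

lemma cdf_gaussian_smoothing:
  "cdf (gaussian_smoothing h M) x = (\<integral>z. cdf M (x - h * z) \<partial>std_normal_distribution)"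
proof -
  have "emeasure (gaussian_smoothing h M) {..x}
     = emeasure (M \<Otimes>\<^sub>M std_normal_distribution) {p. fst p + h * snd p \<le> x}"
    unfolding gaussian_smoothing_def
    by (subst emeasure_distr) (auto simp: space_pair_measure intro!: arg_cong2[where f=emeasure])
  also have "\<dots> = (\<integral>\<^sup>+z. emeasure M ((\<lambda>y. (y, z)) -` {p. fst p + h * snd p \<le> x}) \<partial>std_normal_distribution)"
  proof (rule P.emeasure_pair_measure_alt2)
    have "(\<lambda>p. fst p + h * snd p) -` {..x} \<inter> space (M \<Otimes>\<^sub>M std_normal_distribution)
       \<in> sets (M \<Otimes>\<^sub>M std_normal_distribution)"
      by (rule measurable_sets[where A=borel]) simp_all
    then show "{p. fst p + h * snd p \<le> x} \<in> sets (M \<Otimes>\<^sub>M std_normal_distribution)"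
      by (simp add: space_pair_measure vimage_def)
  qed
  also have "\<dots> = (\<integral>\<^sup>+z. ennreal (cdf M (x - h * z)) \<partial>std_normal_distribution)"
    by (intro nn_integral_cong) (auto simp: cdf_def emeasure_eq_measure vimage_def algebra_simps intro!: arg_cong[where f="measure M"])
  also have "\<dots> = ennreal (\<integral>z. cdf M (x - h * z) \<partial>std_normal_distribution)"
    by (intro nn_integral_eq_integral N.integrable_const_bound[where B=1] measurable_compose[OF _ borel_measurable_cdf])
       (auto simp: cdf_nonneg cdf_bounded_prob)
  finally show ?thesis
    by (simp add: cdf_def measure_def cdf_nonneg integral_nonneg_AE)
qed

lemma char_gaussian_smoothing:
  "char (gaussian_smoothing h M) u = char M u * exp (- (h * u)\<^sup>2 / 2)"
proof -
  have "char (gaussian_smoothing h M) u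
     = (CLINT p|M \<Otimes>\<^sub>M std_normal_distribution. iexp (u * fst p) * iexp (u * h * snd p))"
    unfolding char_def gaussian_smoothing_def
    by (subst integral_distr) (auto simp: split_beta ring_distribs exp_add mult_ac)
  also have "\<dots> = char M u * char std_normal_distribution (u * h)"
    unfolding char_def
    by (subst P.integral_fst'[symmetric])
       (auto intro!: P.integrable_const_bound[where B=1] simp: norm_mult mult.assoc)
  finally show ?thesis
    by (simp add: char_std_normal_distribution mult_ac)
qed

end

lemma std_normal_density_le_1: "std_normal_density x \<le> 1"
proof -
  have "1 / sqrt (2 * pi) * exp (- x\<^sup>2 / 2) \<le> 1 * 1"
    using pi_ge_two by (intro mult_mono) (auto simp: real_le_rsqrt)
  then show ?thesis by (simp add: std_normal_density_def)
qed

lemma cdf_std_normal_Lipschitz: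
  assumes "x \<le> y"
  shows "cdf std_normal_distribution y - cdf std_normal_distribution x \<le> y - x"
proof (cases "x = y")
  case False
  interpret N: real_distribution std_normal_distribution by (rule real_dist_normal_dist)
  have "ennreal (measure std_normal_distribution {x<..y}) = emeasure std_normal_distribution {x<..y}"
    by (simp add: N.emeasure_eq_measure)
  also have "\<dots> = (\<integral>\<^sup>+u. ennreal (std_normal_density u) * indicator {x<..y} u \<partial>lborel)"
    by (simp add: emeasure_density)
  also have "\<dots> \<le> (\<integral>\<^sup>+u. indicator {x<..y} u \<partial>lborel)"
    using std_normal_density_le_1 by (intro nn_integral_mono) (auto split: split_indicator)
  also have "\<dots> = ennreal (y - x)"
    using assms by simp
  finally show ?thesis
    using False assms by (subst N.cdf_diff_eq) auto
qed simp

lemma prob_std_normal_abs_le_2: "measure std_normal_distribution {z. \<bar>z\<bar> \<le> 2} \<ge> 3 / 4"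
proof -
  interpret N: real_distribution std_normal_distribution by (rule real_dist_normal_dist)
  have e: "N.expectation (\<lambda>x. x) = 0" "N.expectation (\<lambda>x. x\<^sup>2) = 1"
    using integral_std_normal_distribution_moment_odd[of 1] std_normal_distribution_even_moments(1)[of 1]
    by simp_all
  have "N.prob {z \<in> space std_normal_distribution. 2 \<le> \<bar>z - N.expectation (\<lambda>x. x)\<bar>}
      \<le> N.variance (\<lambda>x. x) / 2\<^sup>2"
    using integrable_std_normal_distribution_moment[of 2]
    by (intro N.Chebyshev_inequality) auto
  then have "N.prob {z. 2 \<le> \<bar>z\<bar>} \<le> 1 / 4" using e by simp
  moreover have "1 \<le> N.prob {z. \<bar>z\<bar> \<le> 2} + N.prob {z. 2 \<le> \<bar>z\<bar>}"
  proof -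
    have "N.prob UNIV \<le> N.prob ({z. \<bar>z\<bar> \<le> 2} \<union> {z. 2 \<le> \<bar>z\<bar>})"
      by (rule N.finite_measure_mono) auto
    also have "\<dots> \<le> N.prob {z. \<bar>z\<bar> \<le> 2} + N.prob {z. 2 \<le> \<bar>z\<bar>}"
      by (rule measure_Un_le) auto
    finally show ?thesis using N.prob_space by simp
  qed
  ultimately show ?thesis by linarith
qed

text \<open>
  Smoothing loses little: a distribution function is monotone and the normal one is Lipschitz, so a large
  deviation \<open>d\<close> at \<open>x\<close> persists, up to \<open>4 * h\<close>, on an interval of length \<open>4 * h\<close> next to \<open>x\<close>. Averaging over
  an interval centred there, which carries at least \<open>3 / 4\<close> of the mass of the smoothing variable, and using the
  supremum \<open>D\<close> of the deviations elsewhere, bounds \<open>d\<close> by \<open>4 / 3 * B + D / 3 + 4 * h\<close>. Taking the supremum over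
  \<open>x\<close> solves for \<open>D\<close>.
\<close>

lemma (in real_distribution) abs_cdf_diff_le_smoothed:
  assumes h: "0 \<le> h"
    and B: "\<And>x. \<bar>cdf (gaussian_smoothing h M) x - cdf (gaussian_smoothing h std_normal_distribution) x\<bar> \<le> B"
  shows "\<bar>cdf M x - cdf std_normal_distribution x\<bar> \<le> 2 * B + 6 * h"
proof -
  interpret N: real_distribution std_normal_distribution by (rule real_dist_normal_dist)
  let ?\<Phi> = "cdf std_normal_distribution"
  define D where "D = (SUP x. \<bar>cdf M x - ?\<Phi> x\<bar>)"
  have bdd: "bdd_above (range (\<lambda>x. \<bar>cdf M x - ?\<Phi> x\<bar>))"
    by (rule bdd_aboveI2[where M=1])
       (smt (verit) cdf_bounded_prob cdf_nonneg N.cdf_bounded_prob N.cdf_nonneg)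
  have D: "\<bar>cdf M x - ?\<Phi> x\<bar> \<le> D" for x
    unfolding D_def by (rule cSUP_upper[OF _ bdd]) simp
  define p where "p = N.prob {z. \<bar>z\<bar> \<le> 2}"
  have p: "3 / 4 \<le> p" "p \<le> 1"
    using prob_std_normal_abs_le_2 by (simp_all add: p_def)
  have one_sided: "s * (cdf M x - ?\<Phi> x) \<le> 4 / 3 * B + D / 3 + 4 * h"
    if s: "s = 1 \<or> s = -1" for s x
  proof -
    define d where "d = s * (cdf M x - ?\<Phi> x)"
    \<comment> \<open>the sign \<open>s\<close> says on which side of \<open>x\<close> the deviation persists; the shift by \<open>2 * h\<close>
      puts \<open>x\<close> at the end of the window \<open>\<bar>z\<bar> \<le> 2\<close>\<close>
    let ?y = "\<lambda>z. x + 2 * h * s - h * z"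
    have low: "(d - 4 * h + D) * indicator {z. \<bar>z\<bar> \<le> 2} z - D \<le> s * (cdf M (?y z) - ?\<Phi> (?y z))" for z
    proof (cases "\<bar>z\<bar> \<le> 2")
      case True
      then have z: "h * z \<le> h * 2" "h * (-2) \<le> h * z"
        using h by (intro mult_left_mono; simp)+
      show ?thesis
      proof (cases "s = 1")
        case True
        have "cdf M x \<le> cdf M (?y z)" using z True by (intro cdf_nondecreasing) simp
        moreover have "?\<Phi> (?y z) - ?\<Phi> x \<le> ?y z - x" using z True by (intro cdf_std_normal_Lipschitz) simp
        ultimately show ?thesis using \<open>\<bar>z\<bar> \<le> 2\<close> z True by (simp add: d_def)
      next
        case False
        then have s: "s = -1" using s by simp
        have "cdf M (?y z) \<le> cdf M x" using z s by (intro cdf_nondecreasing) simp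
        moreover have "?\<Phi> x - ?\<Phi> (?y z) \<le> x - ?y z" using z s by (intro cdf_std_normal_Lipschitz) simp
        ultimately show ?thesis using \<open>\<bar>z\<bar> \<le> 2\<close> z s by (simp add: d_def)
      qed
    next
      case False
      then show ?thesis using D[of "?y z"] s by auto
    qed
    have int: "integrable std_normal_distribution (\<lambda>z. cdf M (?y z))"
      "integrable std_normal_distribution (\<lambda>z. ?\<Phi> (?y z))"
      by (rule N.integrable_const_bound[where B=1];
          simp add: cdf_nonneg cdf_bounded_prob N.cdf_nonneg N.cdf_bounded_prob)+
    have "(d - 4 * h + D) * p - D = N.expectation (\<lambda>z. (d - 4 * h + D) * indicator {z. \<bar>z\<bar> \<le> 2} z - D)"
      using N.prob_space by (simp add: p_def N.integrable_const_bound[where B=1] N.emeasure_eq_measure)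
    also have "\<dots> \<le> N.expectation (\<lambda>z. s * (cdf M (?y z) - ?\<Phi> (?y z)))"
      using int low by (intro integral_mono) (auto simp: N.emeasure_eq_measure)
    also have "\<dots> = s * (cdf (gaussian_smoothing h M) (x + 2 * h * s)
        - cdf (gaussian_smoothing h std_normal_distribution) (x + 2 * h * s))"
      using int by (simp add: cdf_gaussian_smoothing N.cdf_gaussian_smoothing)
    also have "\<dots> \<le> B"
      using B[of "x + 2 * h * s"] s by auto
    finally have *: "(d - 4 * h + D) * p - D \<le> B" .
    have "0 \<le> B" "0 \<le> D" using B[of 0] D[of 0] by auto
    define q where "q = d - 4 * h + D"
    have "q * (3 / 4) \<le> q * p \<or> q \<le> 0"
      using p(1) by (metis linear mult_left_mono)
    then show ?thesis
      using * \<open>0 \<le> B\<close> \<open>0 \<le> D\<close> unfolding d_def[symmetric] q_def[symmetric] using q_def by linarith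
  qed
  have "\<bar>cdf M x - ?\<Phi> x\<bar> \<le> 4 / 3 * B + D / 3 + 4 * h" for x
    using one_sided[of 1 x, OF disjI1[OF refl]] one_sided[of "-1" x, OF disjI2[OF refl]] by (simp add: abs_le_iff)
  then have "D \<le> 4 / 3 * B + D / 3 + 4 * h"
    unfolding D_def by (intro cSUP_least) auto
  with D[of x] show ?thesis by linarith
qed

text \<open>
  Esseen's smoothing inequality with a Gaussian kernel instead of a band-limited one: smoothing both laws by
  \<open>h\<close> times a standard normal variable multiplies both characteristic functions by \<open>exp (- (h * u)\<^sup>2 / 2)\<close>. The
  frequencies are damped rather than cut off, which is enough when \<open>h\<close> may decay slowly.
\<close>

theorem (in real_distribution) Gaussian_Esseen_inequality:
  assumes "0 \<le> h"
  shows "ennreal \<bar>cdf M x - cdf std_normal_distribution x\<bar>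
    \<le> 2 * (\<integral>\<^sup>+u. ennreal (cmod (char M u - exp (- u\<^sup>2 / 2)) / \<bar>u\<bar> * exp (- (h * u)\<^sup>2 / 2)) \<partial>lborel) + ennreal (6 * h)"
proof (cases "\<integral>\<^sup>+u. ennreal (cmod (char M u - exp (- u\<^sup>2 / 2)) / \<bar>u\<bar> * exp (- (h * u)\<^sup>2 / 2)) \<partial>lborel")
  case (real B)
  interpret N: real_distribution std_normal_distribution by (rule real_dist_normal_dist)
  have "\<bar>cdf (gaussian_smoothing h M) x - cdf (gaussian_smoothing h std_normal_distribution) x\<bar> \<le> B" for x
  proof -
    have "cmod (char (gaussian_smoothing h M) u - char (gaussian_smoothing h std_normal_distribution) u) / \<bar>u\<bar>
      = cmod (char M u - exp (- u\<^sup>2 / 2)) / \<bar>u\<bar> * exp (- (h * u)\<^sup>2 / 2)" for u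
      unfolding char_gaussian_smoothing N.char_gaussian_smoothing char_std_normal_distribution
        left_diff_distrib[symmetric] norm_mult by (simp add: exp_of_real)
    then have "ennreal \<bar>cdf (gaussian_smoothing h M) x - cdf (gaussian_smoothing h std_normal_distribution) x\<bar> \<le> ennreal B"
      using abs_cdf_diff_le_char[OF real_distribution_gaussian_smoothing N.real_distribution_gaussian_smoothing, of h x h]
      by (simp only: real(2))
    then show ?thesis using real(1) by simp
  qed
  from abs_cdf_diff_le_smoothed[OF assms this, of x] real assms
  show ?thesis
    by (metis ennreal_leI ennreal_mult' ennreal_numeral ennreal_plus mult_nonneg_nonneg zero_le_numeral)
qed simp

section \<open>Gaussian averages of characteristic functions\<close>

lemma std_normal_truncated_mean:
  "(\<integral>z. z * indicator {c..} z \<partial>std_normal_distribution) = std_normal_density c"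
proof -
  have deriv: "((\<lambda>z. - std_normal_density z) has_vector_derivative std_normal_density z * z) (at z)" for z
    unfolding std_normal_density_def has_real_derivative_iff_has_vector_derivative[symmetric]
    by (auto intro!: derivative_eq_intros simp: field_simps)
  have lim: "((\<lambda>z. - std_normal_density z) \<longlongrightarrow> - (1 / sqrt (2 * pi) * 0)) at_top"
    unfolding std_normal_density_def
    by (intro tendsto_mult tendsto_minus tendsto_const filterlim_compose[OF exp_at_bot])
       real_asymp
  have "(\<integral>z. z * indicator {c..} z \<partial>std_normal_distribution)
     = (\<integral>z. std_normal_density z * (z * indicator {c..} z) \<partial>lborel)"
    by (subst integral_density) auto
  also have "\<dots> = (LBINT z:{c<..}. std_normal_density z * z)"
    unfolding set_lebesgue_integral_def
  proof (rule integral_cong_AE)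
    show "AE z in lborel. std_normal_density z * (z * indicator {c..} z)
        = indicator {c<..} z *\<^sub>R (std_normal_density z * z)"
      using AE_lborel_singleton[of c] by eventually_elim (auto split: split_indicator)
  qed simp_all
  also have "\<dots> = (LBINT z=ereal c..\<infinity>. std_normal_density z * z)"
    by (simp add: interval_lebesgue_integral_def)
  also have "\<dots> = 0 - (- std_normal_density c)"
  proof (rule interval_integral_FTC_integrable)
    show "set_integrable lborel (einterval (ereal c) \<infinity>) (\<lambda>z. std_normal_density z * z)"
      using integrable_std_normal_moment[of 1] unfolding set_integrable_def
      by (intro integrable_mult_indicator) auto
    show "(((\<lambda>z. - std_normal_density z) \<circ> real_of_ereal) \<longlongrightarrow> - std_normal_density c) (at_right (ereal c))"
      by (simp add: ereal_tendsto_simps std_normal_density_def) (intro tendsto_intros; simp)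
    show "(((\<lambda>z. - std_normal_density z) \<circ> real_of_ereal) \<longlongrightarrow> 0) (at_left \<infinity>)"
      using lim by (simp add: ereal_tendsto_simps)
    show "isCont (\<lambda>z. std_normal_density z * z) x" for x
      unfolding std_normal_density_def by (intro continuous_intros) auto
  qed (use deriv in auto)
  finally show ?thesis by simp
qed

lemma std_normal_abs_moment_le_1: "(\<integral>z. \<bar>z\<bar> \<partial>std_normal_distribution) \<le> 1"
proof -
  have "(\<integral>z. \<bar>z\<bar> \<partial>std_normal_distribution) = sqrt (2 / pi)"
    using std_normal_distribution_odd_moments_abs[of 0] by simp
  also have "\<dots> \<le> 1" using pi_ge_two by simp
  finally show ?thesis .
qed

lemma integrable_std_normal_abs: "integrable std_normal_distribution (\<lambda>z. \<bar>z\<bar>)"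
  using integrable_std_normal_distribution_moment[of 1] by simp

context real_distribution
begin

interpretation N: real_distribution std_normal_distribution
  by (rule real_dist_normal_dist)

interpretation P: pair_prob_space M std_normal_distribution ..

text \<open>
  Integration by parts against the distribution function, written with \<open>std_normal_density c\<close> as the
  truncated mean of a standard normal variable.
\<close>

lemma expectation_std_normal_density:
  "expectation (\<lambda>x. std_normal_density (x - y)) = (\<integral>z. z * cdf M (y + z) \<partial>std_normal_distribution)"
proof -
  let ?f = "\<lambda>x z. z * indicator {x - y..} z :: real"
  have "{p. fst p - y \<le> snd p} = (\<lambda>p. fst p - y - snd p) -` {..0} \<inter> space (borel \<Otimes>\<^sub>M borel)"
    by (auto simp: space_pair_measure)
  also have "\<dots> \<in> sets (borel \<Otimes>\<^sub>M borel)"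
    by (rule measurable_sets[where A=borel]) simp_all
  finally have [measurable]: "Measurable.pred (borel \<Otimes>\<^sub>M borel) (\<lambda>p. fst p - y \<le> snd p)"
    by (simp add: pred_def space_pair_measure)
  have meas: "(\<lambda>(x, z). ?f x z) \<in> borel_measurable (M \<Otimes>\<^sub>M std_normal_distribution)"
  proof -
    have "(\<lambda>p. snd p * (if fst p - y \<le> snd p then 1 else 0)) \<in> borel_measurable (borel \<Otimes>\<^sub>M borel)"
      by measurable
    also have "(\<lambda>p. snd p * (if fst p - y \<le> snd p then 1 else 0)) = (\<lambda>(x, z). ?f x z)"
      by (auto simp: fun_eq_iff)
    finally show ?thesis by (simp cong: measurable_cong_sets)
  qed
  have "integrable (M \<Otimes>\<^sub>M std_normal_distribution) (\<lambda>(x, z). ?f x z)"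
  proof (rule P.Fubini_integrable[OF meas])
    have i': "integrable std_normal_distribution (\<lambda>z. ?f x z)" for x
      by (rule Bochner_Integration.integrable_bound[OF integrable_std_normal_abs]) (auto split: split_indicator)
    then have i: "integrable std_normal_distribution (\<lambda>z. norm (?f x z))" for x
      by (rule integrable_norm)
    have "(\<integral>z. norm (?f x z) \<partial>std_normal_distribution) \<le> 1" for x
      by (rule order_trans[OF _ std_normal_abs_moment_le_1], intro integral_mono i integrable_std_normal_abs)
         (auto split: split_indicator)
    then show "integrable M (\<lambda>x. \<integral>z. norm (case (x, z) of (x, z) \<Rightarrow> ?f x z) \<partial>std_normal_distribution)"
      using meas by (intro integrable_const_bound[where B=1]) (auto simp: case_prod_beta')
    show "AE x in M. integrable std_normal_distribution (\<lambda>z. case (x, z) of (x, z) \<Rightarrow> ?f x z)"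
      using i' by simp
  qed
  note F = P.Fubini_integral[OF this]
  have eq: "(\<lambda>z. \<integral>x. ?f x z \<partial>M) = (\<lambda>z. z * cdf M (y + z))"
  proof
    fix z
    have "(\<integral>x. ?f x z \<partial>M) = (\<integral>x. z * indicator {..y + z} x \<partial>M)"
      by (intro Bochner_Integration.integral_cong) (auto split: split_indicator)
    also have "\<dots> = z * cdf M (y + z)" by (simp add: cdf_def)
    finally show "(\<integral>x. ?f x z \<partial>M) = z * cdf M (y + z)" .
  qed
  show ?thesis
    using F unfolding eq std_normal_truncated_mean by (rule sym)
qed

lemma expectation_std_normal_density_diff_le:
  assumes D: "\<And>x. \<bar>cdf M x - cdf std_normal_distribution x\<bar> \<le> D"
  shows "\<bar>expectation (\<lambda>x. std_normal_density (x - y))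
          - N.expectation (\<lambda>x. std_normal_density (x - y))\<bar> \<le> D"
proof -
  have i: "integrable std_normal_distribution (\<lambda>z. z * F (y + z))"
    if [measurable]: "F \<in> borel_measurable borel" and F: "\<And>x. 0 \<le> F x" "\<And>x. F x \<le> 1" for F :: "real \<Rightarrow> real"
  proof (rule Bochner_Integration.integrable_bound[OF integrable_std_normal_abs])
    show "(\<lambda>z. z * F (y + z)) \<in> borel_measurable std_normal_distribution"
      by measurable
    show "AE z in std_normal_distribution. norm (z * F (y + z)) \<le> norm \<bar>z\<bar>"
    proof (intro AE_I2)
      fix z
      have "\<bar>z\<bar> * \<bar>F (y + z)\<bar> \<le> \<bar>z\<bar>"
        using F[of "y + z"] by (intro mult_left_le) auto
      then show "norm (z * F (y + z)) \<le> norm \<bar>z\<bar>"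
        by (simp only: real_norm_def abs_mult abs_idempotent)
    qed
  qed
  have int: "integrable std_normal_distribution (\<lambda>z. z * cdf M (y + z))"
    "integrable std_normal_distribution (\<lambda>z. z * cdf std_normal_distribution (y + z))"
    by (rule i; simp add: cdf_nonneg cdf_bounded_prob N.cdf_nonneg N.cdf_bounded_prob)+
  have "0 \<le> D" using D[of 0] by simp
  have "\<bar>expectation (\<lambda>x. std_normal_density (x - y)) - N.expectation (\<lambda>x. std_normal_density (x - y))\<bar>
     = \<bar>N.expectation (\<lambda>z. z * cdf M (y + z) - z * cdf std_normal_distribution (y + z))\<bar>"
    unfolding expectation_std_normal_density real_distribution.expectation_std_normal_density[OF real_dist_normal_dist]
    by (rule arg_cong[where f=abs], rule Bochner_Integration.integral_diff[symmetric]; rule int)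
  also have "\<dots> \<le> N.expectation (\<lambda>z. \<bar>z * cdf M (y + z) - z * cdf std_normal_distribution (y + z)\<bar>)"
    by (rule integral_abs_bound)
  also have "\<dots> \<le> N.expectation (\<lambda>z. \<bar>z\<bar> * D)"
  proof (rule integral_mono)
    show "integrable std_normal_distribution (\<lambda>z. \<bar>z * cdf M (y + z) - z * cdf std_normal_distribution (y + z)\<bar>)"
      by (intro integrable_abs Bochner_Integration.integrable_diff int)
    show "integrable std_normal_distribution (\<lambda>z. \<bar>z\<bar> * D)"
      using integrable_std_normal_abs by (rule integrable_mult_left)
    show "\<bar>z * cdf M (y + z) - z * cdf std_normal_distribution (y + z)\<bar> \<le> \<bar>z\<bar> * D" for z
      unfolding right_diff_distrib[symmetric] abs_mult by (intro mult_left_mono D) simp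
  qed
  also have "\<dots> \<le> 1 * D"
    using mult_right_mono[OF std_normal_abs_moment_le_1 \<open>0 \<le> D\<close>] by simp
  finally show ?thesis by simp
qed

text \<open>
  Parseval's formula for the pair of \<open>M\<close> and the standard normal law.
\<close>

lemma expectation_char_std_normal:
  "(CLINT z|std_normal_distribution. char M z) = expectation (\<lambda>x. exp (- x\<^sup>2 / 2))"
proof -
  have "(CLINT z|std_normal_distribution. char M z)
     = (CLINT z|std_normal_distribution. CLINT x|M. iexp (z * x))"
    by (simp add: char_def)
  also have "\<dots> = (CLINT x|M. CLINT z|std_normal_distribution. iexp (z * x))"
    by (rule P.Fubini_integral) (auto intro!: P.integrable_const_bound[where B=1] simp: case_prod_beta)
  also have "\<dots> = (CLINT x|M. char std_normal_distribution x)"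
    by (simp add: char_def mult.commute)
  finally show ?thesis
    unfolding char_std_normal_distribution integral_complex_of_real .
qed

end

definition symmetrization :: "real measure \<Rightarrow> real measure" where
  "symmetrization M = distr (M \<Otimes>\<^sub>M M) borel (\<lambda>(x, y). x - y)"

context real_distribution
begin

interpretation P: pair_prob_space M M ..

lemma real_distribution_symmetrization: "real_distribution (symmetrization M)"
  unfolding symmetrization_def by (intro P.real_distribution_distr) simp

lemma char_symmetrization: "char (symmetrization M) u = complex_of_real ((cmod (char M u))\<^sup>2)"
proof -
  have [measurable]: "cnj \<in> borel_measurable borel"
    by (intro borel_measurable_continuous_onI continuous_intros)
  have "iexp (u * (x - y)) = iexp (u * x) * cnj (iexp (u * y))" for x y :: real
    by (simp add: exp_cnj exp_add[symmetric] algebra_simps)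
  then have "char (symmetrization M) u
     = (CLINT p|M \<Otimes>\<^sub>M M. iexp (u * fst p) * cnj (iexp (u * snd p)))"
    unfolding char_def symmetrization_def
    by (subst integral_distr) (simp_all add: split_beta)
  also have "\<dots> = char M u * cnj (char M u)"
    unfolding char_def
    by (subst P.integral_fst'[symmetric])
       (auto intro!: P.integrable_const_bound[where B=1] simp: norm_mult mult.assoc)
  finally show ?thesis
    unfolding complex_norm_square .
qed

end

text \<open>
  Up to the factor \<open>sqrt (2 * pi)\<close>, the Gaussian average of \<open>\<bar>char\<bar>\<^sup>2\<close> is the double integral of
  \<open>std_normal_density (x - y)\<close>. Replacing \<open>M\<close> by the normal law in one variable at a time costs \<open>D\<close> each, and the
  two mixed terms agree by Fubini's theorem and the symmetry of the kernel.
\<close>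

lemma (in real_distribution) expectation_norm_char_sq_le:
  assumes D: "\<And>x. \<bar>cdf M x - cdf std_normal_distribution x\<bar> \<le> D"
  shows "(\<integral>z. (cmod (char M z))\<^sup>2 - exp (- z\<^sup>2) \<partial>std_normal_distribution) \<le> 6 * D"
proof -
  interpret N: real_distribution std_normal_distribution by (rule real_dist_normal_dist)
  have energy: "(\<integral>z. (cmod (char L z))\<^sup>2 \<partial>std_normal_distribution)
     = sqrt (2 * pi) * (\<integral>y. \<integral>x. std_normal_density (x - y) \<partial>L \<partial>L)"
    if "real_distribution L" for L
  proof -
    interpret L: real_distribution L by (rule that)
    interpret P: pair_prob_space L L ..
    interpret S: real_distribution "symmetrization L" by (rule L.real_distribution_symmetrization)
    have "complex_of_real (\<integral>z. (cmod (char L z))\<^sup>2 \<partial>std_normal_distribution)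
       = (CLINT z|std_normal_distribution. char (symmetrization L) z)"
      unfolding L.char_symmetrization integral_complex_of_real ..
    also have "\<dots> = complex_of_real (S.expectation (\<lambda>x. exp (- x\<^sup>2 / 2)))"
      by (rule S.expectation_char_std_normal)
    finally have "(\<integral>z. (cmod (char L z))\<^sup>2 \<partial>std_normal_distribution) = S.expectation (\<lambda>x. exp (- x\<^sup>2 / 2))"
      by (simp only: of_real_eq_iff)
    also have "\<dots> = S.expectation (\<lambda>x. sqrt (2 * pi) * std_normal_density x)"
      by (simp add: std_normal_density_def)
    also have "\<dots> = sqrt (2 * pi) * (\<integral>p. std_normal_density (fst p - snd p) \<partial>(L \<Otimes>\<^sub>M L))"
      unfolding symmetrization_def by (subst integral_distr) (auto simp: split_beta)
    also have "(\<integral>p. std_normal_density (fst p - snd p) \<partial>(L \<Otimes>\<^sub>M L)) = (\<integral>y. \<integral>x. std_normal_density (x - y) \<partial>L \<partial>L)"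
      using P.integral_snd[of "\<lambda>x y. std_normal_density (x - y)"] std_normal_density_le_1
      by (simp add: case_prod_beta' P.integrable_const_bound[where B=1])
    finally show ?thesis .
  qed
  interpret P: pair_prob_space M std_normal_distribution ..
  let ?G = "\<lambda>L y. \<integral>x. std_normal_density (x - y) \<partial>L"
  have swap: "(\<integral>y. ?G std_normal_distribution y \<partial>M) = (\<integral>y. ?G M y \<partial>std_normal_distribution)"
  proof -
    have sym: "std_normal_density (x - y) = std_normal_density (y - x)" for x y
      by (simp add: std_normal_density_def power2_commute)
    have "(\<integral>y. \<integral>x. std_normal_density (x - y) \<partial>std_normal_distribution \<partial>M)
        = (\<integral>x. \<integral>y. std_normal_density (x - y) \<partial>M \<partial>std_normal_distribution)"
      using std_normal_density_le_1 by (intro P.Fubini_integral[symmetric])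
        (auto simp: case_prod_beta' P.integrable_const_bound[where B=1])
    then show ?thesis by (subst (asm) (2) sym)
  qed
  have G1: "0 \<le> ?G L y" "?G L y \<le> 1" if "real_distribution L" for L y
  proof -
    interpret L: real_distribution L by (rule that)
    show "0 \<le> ?G L y" by (simp add: integral_nonneg_AE)
    have "?G L y \<le> (\<integral>x. 1 \<partial>L)" using std_normal_density_le_1
      by (intro integral_mono L.integrable_const_bound[where B=1]) auto
    then show "?G L y \<le> 1" using L.prob_space by simp
  qed
  have Gm: "?G L \<in> borel_measurable borel" if "real_distribution L" for L
  proof -
    interpret L: real_distribution L by (rule that)
    show ?thesis by measurable
  qed
  have Gi: "integrable L' (?G L)" if "real_distribution L" "real_distribution L'" for L L'
  proof -
    interpret L': real_distribution L' by (rule that)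
    show ?thesis
      using Gm[OF that(1)] G1[OF that(1)] by (intro L'.integrable_const_bound[where B=1]) auto
  qed
  note M = real_distribution_axioms and N = real_dist_normal_dist
  have diff: "(\<integral>y. ?G M y \<partial>L) - (\<integral>y. ?G std_normal_distribution y \<partial>L) \<le> D" if L: "real_distribution L" for L
  proof -
    interpret L: real_distribution L by (rule L)
    have "(\<integral>y. ?G M y \<partial>L) - (\<integral>y. ?G std_normal_distribution y \<partial>L)
       = (\<integral>y. ?G M y - ?G std_normal_distribution y \<partial>L)"
      by (intro Bochner_Integration.integral_diff[symmetric] Gi L M N)
    also have "\<dots> \<le> (\<integral>y. D \<partial>L)"
      using expectation_std_normal_density_diff_le[OF D]
      by (intro integral_mono Bochner_Integration.integrable_diff Gi L M N) (auto simp: abs_le_iff)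
    finally show ?thesis using L.prob_space by simp
  qed
  have "cmod (char std_normal_distribution z) ^ 2 = exp (- z\<^sup>2)" for z
    by (simp add: char_std_normal_distribution norm_exp_eq_Re exp_double[symmetric] flip: exp_of_real)
  moreover have "(cmod (char M z))\<^sup>2 \<le> 1" for z
    by (simp add: power_le_one cmod_char_le_1)
  ultimately have "(\<integral>z. (cmod (char M z))\<^sup>2 - exp (- z\<^sup>2) \<partial>std_normal_distribution)
     = (\<integral>z. (cmod (char M z))\<^sup>2 \<partial>std_normal_distribution) - (\<integral>z. (cmod (char std_normal_distribution z))\<^sup>2 \<partial>std_normal_distribution)"
    by (subst Bochner_Integration.integral_diff)
       (auto intro!: N.integrable_const_bound[where B=1])
  also have "\<dots> = sqrt (2 * pi) * ((\<integral>y. ?G M y \<partial>M) - (\<integral>y. ?G std_normal_distribution y \<partial>std_normal_distribution))"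
    unfolding energy[OF M] energy[OF N] by (simp add: right_diff_distrib)
  also have "\<dots> \<le> sqrt (2 * pi) * (2 * D)"
    using diff[OF M] diff[OF N] swap by (intro mult_left_mono) auto
  also have "\<dots> \<le> 3 * (2 * D)"
    using D[of 0] pi_less_4 by (intro mult_right_mono real_le_lsqrt) auto
  finally show ?thesis by simp
qed

section \<open>Laws of a Levy process\<close>

lemma (in real_distribution) cmod_char_minus_1_le:
  assumes "integrable M (\<lambda>x. x)"
  shows "cmod (char M u - 1) \<le> \<bar>u\<bar> * expectation (\<lambda>x. \<bar>x\<bar>)"
proof -
  have int: "integrable M (\<lambda>x. iexp (u * x))"
    by (intro integrable_const_bound[where B=1]) auto
  have "char M u - 1 = (CLINT x|M. iexp (u * x) - 1)"
    using int prob_space by (simp add: char_def)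
  also have "cmod \<dots> \<le> expectation (\<lambda>x. cmod (iexp (u * x) - 1))"
    by (rule integral_norm_bound)
  also have "\<dots> \<le> expectation (\<lambda>x. \<bar>u\<bar> * \<bar>x\<bar>)"
  proof (rule integral_mono)
    show "integrable M (\<lambda>x. cmod (iexp (u * x) - 1))"
      using int by (intro integrable_norm Bochner_Integration.integrable_diff) auto
    show "integrable M (\<lambda>x. \<bar>u\<bar> * \<bar>x\<bar>)"
      using assms by simp
    show "cmod (iexp (u * x) - 1) \<le> \<bar>u\<bar> * \<bar>x\<bar>" for x
      using iexp_approx1[of "u * x" 0] by (simp add: abs_mult)
  qed
  finally show ?thesis by simp
qed

context levy_process
begin

abbreviation law :: "real \<Rightarrow> real measure" where
  "law t \<equiv> distr M borel (X t)"

lemma real_distribution_law: "0 \<le> t \<Longrightarrow> real_distribution (law t)"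
  by (intro real_distribution_distr random_variable)

text \<open>
  The process starts at \<open>0\<close> only almost surely, which is enough for laws.
\<close>

lemma law_increment:
  assumes "0 \<le> s" "0 \<le> h"
  shows "distr M borel (\<lambda>\<omega>. X (s + h) \<omega> - X s \<omega>) = law h"
proof -
  have [measurable]: "X h \<in> borel_measurable M" "X 0 \<in> borel_measurable M"
    using assms by (auto intro: random_variable)
  have "distr M borel (\<lambda>\<omega>. X h \<omega> - X 0 \<omega>) = law h"
    by (rule distr_cong_AE[OF refl]) (use start_zero in auto)
  with stationary_increments[OF assms] show ?thesis by simp
qed

lemma indep_increments:
  assumes "0 < s" "0 < h"
  shows "indep_var borel (\<lambda>\<omega>. X s \<omega> - X 0 \<omega>) borel (\<lambda>\<omega>. X (s + h) \<omega> - X s \<omega>)"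
proof -
  define t :: "nat \<Rightarrow> real" where "t i = (if i = 0 then 0 else if i = 1 then s else s + h)" for i
  have "indep_vars (\<lambda>_. borel) (\<lambda>i \<omega>. X (t (Suc i)) \<omega> - X (t i) \<omega>) {..<2}"
    using assms by (intro independent_increments) (auto simp: t_def)
  moreover have "{..<2} = insert (0::nat) {1}" by auto
  ultimately show ?thesis
    using indep_vars_sum[of "{1::nat}" 0 "\<lambda>i \<omega>. X (t (Suc i)) \<omega> - X (t i) \<omega>"]
    by (simp add: t_def)
qed

lemma law_add:
  assumes "0 < s" "0 < h"
  shows "law (s + h) = (law s \<star> law h)"
proof -
  have "law (s + h) = distr M borel (\<lambda>\<omega>. (X s \<omega> - X 0 \<omega>) + (X (s + h) \<omega> - X s \<omega>))"
    using law_increment[of 0 "s + h"] assms by simp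
  also have "\<dots> = (law s \<star> law h)"
  proof (subst sum_indep_random_variable[OF indep_increments[OF assms]])
    show "random_variable borel (\<lambda>\<omega>. X s \<omega> - X 0 \<omega>)" "random_variable borel (\<lambda>\<omega>. X (s + h) \<omega> - X s \<omega>)"
      using assms by (auto intro!: borel_measurable_diff random_variable)
  qed (use assms law_increment[of 0 s] law_increment[of s h] in simp)
  finally show ?thesis .
qed

lemma char_law_0: "char (law 0) u = 1"
proof -
  have "law 0 = distr M borel (\<lambda>_. 0)"
    by (rule distr_cong_AE[OF refl]) (use start_zero random_variable[of 0] in auto)
  then show ?thesis
    by (simp add: char_def integral_distr prob_space del: distr_const)
qed

lemma char_law_add:
  assumes "0 \<le> s" "0 \<le> h"
  shows "char (law (s + h)) u = char (law s) u * char (law h) u"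
proof (cases "0 < s \<and> 0 < h")
  case True
  then have "law (s + h) = distr M borel (\<lambda>\<omega>. (X s \<omega> - X 0 \<omega>) + (X (s + h) \<omega> - X s \<omega>))"
    using law_increment[of 0 "s + h"] by simp
  with char_distr_add[OF indep_increments, of s h u] True
    law_increment[of 0 s] law_increment[of s h] show ?thesis by simp
next
  case False
  with assms have "s = 0 \<or> h = 0" by auto
  then show ?thesis by (auto simp: char_law_0)
qed

text \<open>
  The form in which infinite divisibility is used: only integer powers of \<open>\<phi>\<^sub>1\<close> occur, at the price of one more
  factor for the fractional part of the time.
\<close>

lemma char_law_of_nat_add:
  assumes "0 \<le> s"
  shows "char (law (real n + s)) u = char (law 1) u ^ n * char (law s) u"
proof (induction n)
  case (Suc n)
  have "char (law (1 + (real n + s))) u = char (law 1) u * char (law (real n + s)) u"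
    using assms by (intro char_law_add) auto
  with Suc show ?case by (simp add: algebra_simps)
qed simp

text \<open>
  The factor \<open>\<phi>\<^sub>s\<close> of the fractional part is bounded below by \<open>\<phi>\<^sub>1\<close>, because the remaining factor
  \<open>\<phi>\<^sub>1\<^sub>-\<^sub>s\<close> has modulus at most \<open>1\<close>.
\<close>

lemma cmod_char_law_1_le:
  assumes "0 \<le> s" "s \<le> 1"
  shows "cmod (char (law 1) u) \<le> cmod (char (law s) u)"
proof -
  have "char (law 1) u = char (law s) u * char (law (1 - s)) u"
    using char_law_add[of s "1 - s" u] assms by simp
  moreover have "cmod (char (law (1 - s)) u) \<le> 1"
    using assms by (intro real_distribution.cmod_char_le_1 real_distribution_law) simp
  ultimately show ?thesis
    by (simp add: norm_mult mult_left_le)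
qed

text \<open>
  Otherwise there are times \<open>s n\<close> at which the mass in \<open>[-n, n]\<close> is below \<open>1 / 2\<close>. By compactness they
  accumulate at some \<open>l\<close>, and stochastic continuity at \<open>l\<close> contradicts the finiteness of \<open>X l\<close>.
\<close>

lemma tight_on_unit_interval:
  obtains K where "0 \<le> K" "\<And>s. 0 \<le> s \<Longrightarrow> s \<le> 1 \<Longrightarrow> 1 / 2 \<le> prob {\<omega> \<in> space M. \<bar>X s \<omega>\<bar> \<le> K}"
proof (rule ccontr)
  assume "\<not> thesis"
  have "\<exists>s. 0 \<le> s \<and> s \<le> 1 \<and> prob {\<omega> \<in> space M. \<bar>X s \<omega>\<bar> \<le> real n} < 1 / 2" for n :: nat
    using \<open>\<not> thesis\<close> that[of "real n"] by (meson not_le of_nat_0_le_iff)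
  then obtain s where s: "\<And>n. 0 \<le> s n" "\<And>n. s n \<le> 1"
    and lt: "\<And>n. prob {\<omega> \<in> space M. \<bar>X (s n) \<omega>\<bar> \<le> real n} < 1 / 2"
    by metis
  have "seq_compact {0..1::real}" by (simp add: compact_imp_seq_compact)
  then obtain l r where l: "l \<in> {0..1}" and r: "strict_mono r" and lim: "(s \<circ> r) \<longlonglongrightarrow> l"
    using s by (elim seq_compactE[where f=s]) auto
  have rv: "X t \<in> borel_measurable M" if "0 \<le> t" for t
    using random_variable[OF that] .
  have [measurable]: "X l \<in> borel_measurable M" "X (s n) \<in> borel_measurable M" for n
    using l s by (auto intro: rv)
  have 1: "(\<lambda>n. prob {\<omega> \<in> space M. \<bar>X (s (r n)) \<omega> - X l \<omega>\<bar> > 1}) \<longlonglongrightarrow> 0"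
  proof -
    let ?g = "\<lambda>t. prob {\<omega> \<in> space M. \<bar>X t \<omega> - X l \<omega>\<bar> > 1}"
    have "(?g \<longlongrightarrow> ?g l) (at l within {0..})"
      using stochastically_continuous[of l 1] l by simp
    then have "continuous (at l within {0..}) ?g"
      by (simp add: continuous_within)
    then have "(\<lambda>n. ?g ((s \<circ> r) n)) \<longlonglongrightarrow> ?g l"
      using lim s by (intro continuous_within_tendsto_compose'[of l "{0..}" ?g]) (auto simp: o_def)
    then show ?thesis by simp
  qed
  have 2: "(\<lambda>n. prob {\<omega> \<in> space M. \<bar>X l \<omega>\<bar> \<le> real (r n) - 1}) \<longlonglongrightarrow> 1"
  proof -
    have "(\<lambda>n. measure (law l) {- (real (r n) - 1) .. real (r n) - 1}) \<longlonglongrightarrow> measure (law l) (\<Union>n. {- (real (r n) - 1) .. real (r n) - 1})"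
    proof (rule finite_measure.finite_Lim_measure_incseq)
      show "finite_measure (law l)"
        using real_distribution_law[of l] l by (simp add: real_distribution_def prob_space_def)
      show "incseq (\<lambda>n. {- (real (r n) - 1)..real (r n) - 1})"
        using strict_mono_mono[OF r] by (auto simp: incseq_def mono_def)
    qed auto
    also have "(\<Union>n. {- (real (r n) - 1) .. real (r n) - 1}) = UNIV"
    proof -
      have "\<exists>n. x \<in> {- (real (r n) - 1) .. real (r n) - 1}" for x
      proof -
        obtain n where "\<bar>x\<bar> + 1 \<le> real n" using real_arch_simple by blast
        moreover have "n \<le> r n" using r by (rule seq_suble)
        ultimately have "\<bar>x\<bar> + 1 \<le> real (r n)" by linarith
        then show ?thesis by (intro exI[of _ n]) auto
      qed
      then show ?thesis by auto
    qed
    also have "measure (law l) UNIV = 1"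
      using real_distribution_law[of l] l prob_space.prob_space[of "law l"] by (simp add: real_distribution_def)
    finally have "(\<lambda>n. measure (law l) {- (real (r n) - 1) .. real (r n) - 1}) \<longlonglongrightarrow> 1" .
    moreover have "measure (law l) {- (real (r n) - 1) .. real (r n) - 1} = prob {\<omega> \<in> space M. \<bar>X l \<omega>\<bar> \<le> real (r n) - 1}" for n
      by (subst measure_distr) (auto intro!: arg_cong[where f=prob])
    ultimately show ?thesis by simp
  qed
  have "\<forall>\<^sub>F n in sequentially. prob {\<omega> \<in> space M. \<bar>X (s (r n)) \<omega> - X l \<omega>\<bar> > 1} < 1 / 4"
    using 1 by (rule order_tendstoD) simp
  moreover have "\<forall>\<^sub>F n in sequentially. prob {\<omega> \<in> space M. \<bar>X l \<omega>\<bar> \<le> real (r n) - 1} > 3 / 4"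
    using 2 by (rule order_tendstoD) simp
  ultimately have "\<forall>\<^sub>F n in sequentially. False"
  proof eventually_elim
    case (elim n)
    have "prob {\<omega> \<in> space M. \<bar>X l \<omega>\<bar> \<le> real (r n) - 1}
       \<le> prob ({\<omega> \<in> space M. \<bar>X (s (r n)) \<omega>\<bar> \<le> real (r n)} \<union> {\<omega> \<in> space M. \<bar>X (s (r n)) \<omega> - X l \<omega>\<bar> > 1})"
      by (intro finite_measure_mono) auto
    also have "\<dots> \<le> prob {\<omega> \<in> space M. \<bar>X (s (r n)) \<omega>\<bar> \<le> real (r n)} + prob {\<omega> \<in> space M. \<bar>X (s (r n)) \<omega> - X l \<omega>\<bar> > 1}"
      by (rule measure_Un_le) auto
    finally show False using elim lt[of "r n"] by linarith
  qed
  then show False by simp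
qed

text \<open>
  \<open>X 1\<close> is the sum of \<open>X s\<close> and an independent increment that is at most \<open>K\<close> in modulus with probability at
  least \<open>1 / 2\<close>, by tightness. On that event \<open>\<bar>X s\<bar> \<le> \<bar>X 1\<bar> + K\<close>, and independence separates the
  factor \<open>1 / 2\<close>.
\<close>

lemma bounded_first_moment_on_unit_interval:
  assumes int1: "integrable M (X 1)"
  obtains C where "0 \<le> C" "\<And>s. 0 \<le> s \<Longrightarrow> s \<le> 1 \<Longrightarrow> integrable (law s) (\<lambda>x. x)"
    "\<And>s. 0 \<le> s \<Longrightarrow> s \<le> 1 \<Longrightarrow> (\<integral>x. \<bar>x\<bar> \<partial>law s) \<le> C"
proof -
  obtain K where K: "0 \<le> K" "\<And>s. 0 \<le> s \<Longrightarrow> s \<le> 1 \<Longrightarrow> 1 / 2 \<le> prob {\<omega> \<in> space M. \<bar>X s \<omega>\<bar> \<le> K}"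
    using tight_on_unit_interval by blast
  define E where "E = expectation (\<lambda>\<omega>. \<bar>X 1 \<omega>\<bar>)"
  have "0 \<le> E" by (simp add: E_def)
  have E: "(\<integral>\<^sup>+x. ennreal \<bar>x\<bar> \<partial>law 1) = ennreal E"
    using int1 by (simp add: E_def nn_integral_distr random_variable nn_integral_eq_integral)
  define C where "C = 2 * (E + K)"
  have main: "(\<integral>\<^sup>+x. ennreal \<bar>x\<bar> \<partial>law s) \<le> ennreal C" if s: "0 \<le> s" "s \<le> 1" for s
  proof -
    consider "s = 0" | "s = 1" | "0 < s" "s < 1" using s by force
    then show ?thesis
    proof cases
      case 1
      have "(\<integral>\<^sup>+x. ennreal \<bar>x\<bar> \<partial>law 0) = (\<integral>\<^sup>+\<omega>. ennreal \<bar>X 0 \<omega>\<bar> \<partial>M)"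
        by (rule nn_integral_distr) (auto intro: random_variable)
      also have "\<dots> = 0"
        using start_zero random_variable[of 0] by (subst nn_integral_0_iff_AE) auto
      finally show ?thesis using 1 by simp
    next
      case 2
      have "E \<le> C" using \<open>0 \<le> E\<close> K(1) by (simp add: C_def)
      then show ?thesis unfolding 2 E by (rule ennreal_leI)
    next
      case 3
      define \<alpha> where "\<alpha> = law s"
      define \<beta> where "\<beta> = law (1 - s)"
      interpret a: real_distribution \<alpha> unfolding \<alpha>_def by (rule real_distribution_law[OF s(1)])
      interpret b: real_distribution \<beta> unfolding \<beta>_def using s by (intro real_distribution_law) simp
      have pb: "1 / 2 \<le> b.prob {x. \<bar>x\<bar> \<le> K}"
        using K(2)[of "1 - s"] s random_variable[of "1 - s"]
        by (simp add: \<beta>_def measure_distr vimage_def Int_def conj_commute)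
      have "(\<integral>\<^sup>+x. ennreal \<bar>x\<bar> \<partial>\<alpha>) * ennreal (1 / 2) \<le> (\<integral>\<^sup>+x. ennreal \<bar>x\<bar> \<partial>\<alpha>) * emeasure \<beta> {x. \<bar>x\<bar> \<le> K}"
        unfolding b.emeasure_eq_measure using pb by (intro mult_left_mono ennreal_leI) auto
      also have "\<dots> = (\<integral>\<^sup>+y. (\<integral>\<^sup>+x. ennreal \<bar>x\<bar> \<partial>\<alpha>) * indicator {x. \<bar>x\<bar> \<le> K} y \<partial>\<beta>)"
        by (rule nn_integral_cmult_indicator[symmetric]) simp
      also have "\<dots> \<le> (\<integral>\<^sup>+y. \<integral>\<^sup>+x. ennreal \<bar>x + y\<bar> + ennreal K \<partial>\<alpha> \<partial>\<beta>)"
      proof (rule nn_integral_mono)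
        fix y
        show "(\<integral>\<^sup>+x. ennreal \<bar>x\<bar> \<partial>\<alpha>) * indicator {x. \<bar>x\<bar> \<le> K} y \<le> (\<integral>\<^sup>+x. ennreal \<bar>x + y\<bar> + ennreal K \<partial>\<alpha>)"
          using K(1) by (auto intro!: nn_integral_mono ennreal_leI split: split_indicator simp flip: ennreal_plus)
      qed
      also have "\<dots> = (\<integral>\<^sup>+y. \<integral>\<^sup>+x. ennreal \<bar>x + y\<bar> \<partial>\<alpha> \<partial>\<beta>) + ennreal K"
        by (simp add: nn_integral_add a.emeasure_space_1[simplified] b.emeasure_space_1[simplified])
      also have "(\<integral>\<^sup>+y. \<integral>\<^sup>+x. ennreal \<bar>x + y\<bar> \<partial>\<alpha> \<partial>\<beta>) = (\<integral>\<^sup>+x. ennreal \<bar>x\<bar> \<partial>(\<beta> \<star> \<alpha>))"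
        by (subst nn_integral_convolution) (auto simp: add.commute a.finite_measure_axioms b.finite_measure_axioms)
      also have "(\<beta> \<star> \<alpha>) = law 1"
        using law_add[of "1 - s" s] 3 by (simp add: \<alpha>_def \<beta>_def)
      finally have "(\<integral>\<^sup>+x. ennreal \<bar>x\<bar> \<partial>\<alpha>) * ennreal (1 / 2) \<le> ennreal (E + K)"
        using E \<open>0 \<le> E\<close> K(1) by simp
      then have "(\<integral>\<^sup>+x. ennreal \<bar>x\<bar> \<partial>\<alpha>) * ennreal (1 / 2) * ennreal 2 \<le> ennreal (E + K) * ennreal 2"
        by (rule mult_right_mono) simp
      also have "(\<integral>\<^sup>+x. ennreal \<bar>x\<bar> \<partial>\<alpha>) * ennreal (1 / 2) * ennreal 2 = (\<integral>\<^sup>+x. ennreal \<bar>x\<bar> \<partial>\<alpha>)"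
        unfolding mult.assoc ennreal_mult''[symmetric, OF zero_le_numeral] by simp
      also have "ennreal (E + K) * ennreal 2 = ennreal C"
        unfolding C_def using \<open>0 \<le> E\<close> K(1) by (subst ennreal_mult''[symmetric]) (auto simp: mult.commute)
      finally show ?thesis by (simp add: \<alpha>_def)
    qed
  qed
  have "0 \<le> C" using \<open>0 \<le> E\<close> K(1) by (simp add: C_def)
  show ?thesis
  proof (rule that[OF \<open>0 \<le> C\<close>])
    fix s :: real assume s: "0 \<le> s" "s \<le> 1"
    have "(\<integral>\<^sup>+x. ennreal (norm x) \<partial>law s) < \<infinity>"
      using main[OF s] by (auto intro: le_less_trans)
    then show int: "integrable (law s) (\<lambda>x. x)"
      by (intro integrableI_bounded) auto
    have "ennreal (\<integral>x. \<bar>x\<bar> \<partial>law s) \<le> ennreal C"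
      using int main[OF s] by (subst nn_integral_eq_integral[symmetric]) auto
    then show "(\<integral>x. \<bar>x\<bar> \<partial>law s) \<le> C"
      using \<open>0 \<le> C\<close> by simp
  qed
qed

end

section \<open>The Lindeberg moment\<close>

text \<open>
  The source of the logarithm in the upper bound: the integrand is \<open>1 / t\<close> up to \<open>t = a\<^sup>2\<close> and integrable
  beyond.
\<close>

lemma nn_integral_min_inverse_sqrt_le:
  assumes "0 \<le> a"
  shows "(\<integral>\<^sup>+t. ennreal (min 1 (a / sqrt t) / t) * indicator {1..} t \<partial>lborel) \<le> ennreal (2 + 2 * max 0 (ln a))"
proof -
  define m where "m = max 1 (a\<^sup>2)"
  have m: "1 \<le> m" "a \<le> sqrt m"
    using real_le_rsqrt[of a m] by (auto simp: m_def)
  have "(\<integral>\<^sup>+t. ennreal (min 1 (a / sqrt t) / t) * indicator {1..} t \<partial>lborel)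
     \<le> (\<integral>\<^sup>+t. ennreal (1 / t) * indicator {1..m} t + ennreal (a / (t * sqrt t)) * indicator {m..} t \<partial>lborel)"
  proof (rule nn_integral_mono)
    fix t :: real
    show "ennreal (min 1 (a / sqrt t) / t) * indicator {1..} t
       \<le> ennreal (1 / t) * indicator {1..m} t + ennreal (a / (t * sqrt t)) * indicator {m..} t"
    proof (cases "t \<le> m")
      case True
      then show ?thesis
        by (auto split: split_indicator intro!: ennreal_leI divide_right_mono add_increasing2)
    next
      case False
      have "min 1 (a / sqrt t) / t \<le> (a / sqrt t) / t"
        using False m by (intro divide_right_mono) auto
      then show ?thesis using False m by (auto split: split_indicator intro!: ennreal_leI simp: mult.commute)
    qed
  qed
  also have "\<dots> = (\<integral>\<^sup>+t. ennreal (1 / t) * indicator {1..m} t \<partial>lborel) + (\<integral>\<^sup>+t. ennreal (a / (t * sqrt t)) * indicator {m..} t \<partial>lborel)"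
    by (rule nn_integral_add) auto
  also have "(\<integral>\<^sup>+t. ennreal (1 / t) * indicator {1..m} t \<partial>lborel) = ennreal (ln m - ln 1)"
    using m by (intro nn_integral_FTC_Icc) (auto intro!: derivative_eq_intros)
  also have "(\<integral>\<^sup>+t. ennreal (a / (t * sqrt t)) * indicator {m..} t \<partial>lborel) = ennreal (0 - (- 2 * a / sqrt m))"
  proof (rule nn_integral_FTC_atLeast)
    show "((\<lambda>t. - 2 * a / sqrt t) \<longlongrightarrow> 0) at_top"
      by (intro tendsto_divide_0[OF tendsto_const] filterlim_at_top_imp_at_infinity sqrt_at_top)
    fix t assume "m \<le> t"
    with m(1) have "0 < t" by simp
    then show "((\<lambda>t. - 2 * a / sqrt t) has_real_derivative a / (t * sqrt t)) (at t)"
      by (auto intro!: derivative_eq_intros simp: field_simps)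
    show "0 \<le> a / (t * sqrt t)" using \<open>0 < t\<close> assms by simp
  qed simp
  also have "ennreal (ln m - ln 1) + ennreal (0 - (- 2 * a / sqrt m)) \<le> ennreal (2 * max 0 (ln a)) + ennreal 2"
  proof (intro add_mono ennreal_leI)
    show "ln m - ln 1 \<le> 2 * max 0 (ln a)"
    proof (cases "1 < a\<^sup>2")
      case True
      then have "m = a\<^sup>2" "0 < a" using assms by (auto simp: m_def intro: neq_le_trans)
      then show ?thesis by (simp add: ln_realpow)
    qed (simp add: m_def)
    show "0 - (- 2 * a / sqrt m) \<le> 2" using m by (simp add: field_simps)
  qed
  also have "\<dots> = ennreal (2 + 2 * max 0 (ln a))"
    by (subst ennreal_plus[symmetric]) (auto simp: add.commute)
  finally show ?thesis .
qed

lemma ln_plus_mult_le: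
  fixes a b :: real
  assumes "0 \<le> a" "0 \<le> b"
  shows "max 0 (ln (a * b)) \<le> a + max 0 (ln b)"
proof (cases "a = 0 \<or> b = 0")
  case False
  then have "ln (a * b) = ln a + ln b" "ln a \<le> a - 1"
    using assms by (auto simp: ln_mult intro: ln_le_minus_one)
  then show ?thesis using assms by auto
qed (use assms in auto)

lemma norm_power_diff_le:
  fixes z w :: complex
  assumes "norm z \<le> r" "norm w \<le> r" "0 < r"
  shows "norm (z ^ n - w ^ n) \<le> real n * r ^ n / r * norm (z - w)"
proof -
  have "norm ((z / r) ^ n - (w / r) ^ n) \<le> n * norm (z / r - w / r)"
    using assms by (intro norm_power_diff) (auto simp: norm_divide)
  also have "z / r - w / r = (z - w) / r" by (simp add: diff_divide_distrib)
  also have "norm ((z - w) / complex_of_real r) = norm (z - w) / r"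
    using assms by (simp add: norm_divide)
  finally have "r ^ n * norm ((z / r) ^ n - (w / r) ^ n) \<le> r ^ n * (n * (norm (z - w) / r))"
    using assms by (intro mult_left_mono) auto
  moreover have "z ^ n - w ^ n = complex_of_real (r ^ n) * ((z / r) ^ n - (w / r) ^ n)"
    using assms by (simp add: power_divide right_diff_distrib)
  then have "norm (z ^ n - w ^ n) = r ^ n * norm ((z / r) ^ n - (w / r) ^ n)"
    using assms by (metis abs_of_pos norm_mult norm_of_real zero_less_power)
  ultimately show ?thesis by (simp add: mult_ac)
qed

text \<open>
  A second moment in which the values of modulus below \<open>1 / \<bar>w\<bar>\<close> are damped, as in Lindeberg's condition; it
  tends to \<open>0\<close> with \<open>w\<close> and measures the error of the quadratic approximation of the characteristic function.
\<close>

definition lindeberg_moment :: "real measure \<Rightarrow> real \<Rightarrow> real" where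
  "lindeberg_moment M w = (\<integral>x. x\<^sup>2 * min 1 \<bar>w * x\<bar> \<partial>M)"

context real_distribution
begin

context
  assumes sq: "integrable M (\<lambda>x. x\<^sup>2)"
begin

lemma integrable_lindeberg: "integrable M (\<lambda>x. x\<^sup>2 * min 1 \<bar>w * x\<bar>)"
  by (rule Bochner_Integration.integrable_bound[OF sq]) (auto simp: abs_mult intro!: mult_left_le)

lemma lindeberg_moment_nonneg: "0 \<le> lindeberg_moment M w"
  unfolding lindeberg_moment_def by (intro integral_nonneg_AE) auto

lemma lindeberg_moment_tendsto_0: "(lindeberg_moment M \<longlongrightarrow> 0) (at 0)"
  unfolding tendsto_at_iff_sequentially o_def
proof (intro allI impI)
  fix W :: "nat \<Rightarrow> real" assume W: "W \<longlonglongrightarrow> 0"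
  have "(\<lambda>n. \<integral>x. x\<^sup>2 * min 1 \<bar>W n * x\<bar> \<partial>M) \<longlonglongrightarrow> (\<integral>x. x\<^sup>2 * min 1 \<bar>0 * x\<bar> \<partial>M)"
  proof (rule integral_dominated_convergence[OF _ _ sq])
    show "AE x in M. (\<lambda>n. x\<^sup>2 * min 1 \<bar>W n * x\<bar>) \<longlonglongrightarrow> x\<^sup>2 * min 1 \<bar>0 * x\<bar>"
      by (intro AE_I2 tendsto_intros W)
    show "AE x in M. norm (x\<^sup>2 * min 1 \<bar>W n * x\<bar>) \<le> x\<^sup>2" for n
      by (intro AE_I2) (auto simp: abs_mult intro!: mult_left_le)
  qed simp_all
  then show "(\<lambda>n. lindeberg_moment M (W n)) \<longlonglongrightarrow> 0"
    by (simp add: lindeberg_moment_def)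
qed

lemma borel_measurable_lindeberg_moment [measurable]: "lindeberg_moment M \<in> borel_measurable borel"
  unfolding lindeberg_moment_def by measurable

lemma char_quadratic_approx:
  assumes "expectation (\<lambda>x. x) = 0" and v: "expectation (\<lambda>x. x\<^sup>2) = v"
  shows "cmod (char M w - (1 - w\<^sup>2 * v / 2)) \<le> w\<^sup>2 * lindeberg_moment M w"
proof -
  have i1: "integrable M (\<lambda>x. x)"
    using sq by (rule square_integrable_imp_integrable[rotated]) simp
  have "cmod (char M w - (1 - w\<^sup>2 * v / 2)) \<le> w\<^sup>2 / 6 * expectation (\<lambda>x. min (6 * x\<^sup>2) (\<bar>w\<bar> * \<bar>x\<bar> ^ 3))"
    using i1 sq assms by (intro char_approx3) auto
  also have "\<dots> \<le> w\<^sup>2 / 6 * expectation (\<lambda>x. 6 * (x\<^sup>2 * min 1 \<bar>w * x\<bar>))"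
  proof (intro mult_left_mono integral_mono)
    have nn: "0 \<le> \<bar>w\<bar> * \<bar>x\<bar> ^ 3" for x by simp
    show "integrable M (\<lambda>x. min (6 * x\<^sup>2) (\<bar>w\<bar> * \<bar>x\<bar> ^ 3))"
    proof (rule Bochner_Integration.integrable_bound)
      show "integrable M (\<lambda>x. 6 * x\<^sup>2)" using sq by simp
      show "AE x in M. norm (min (6 * x\<^sup>2) (\<bar>w\<bar> * \<bar>x\<bar> ^ 3)) \<le> norm (6 * x\<^sup>2)"
        using nn by (intro AE_I2) (simp add: abs_le_iff min_le_iff_disj)
    qed measurable
    show "integrable M (\<lambda>x. 6 * (x\<^sup>2 * min 1 \<bar>w * x\<bar>))"
      using integrable_lindeberg by simp
    fix x :: real
    have "\<bar>x\<bar> ^ 3 = x\<^sup>2 * \<bar>x\<bar>"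
      by (simp add: power3_eq_cube power2_eq_square)
    then have eq: "\<bar>w\<bar> * \<bar>x\<bar> ^ 3 = x\<^sup>2 * \<bar>w * x\<bar>"
      by (simp add: abs_mult)
    have m: "x\<^sup>2 * min 1 \<bar>w * x\<bar> = min (x\<^sup>2) (x\<^sup>2 * \<bar>w * x\<bar>)"
      using mult_min_right[of "x\<^sup>2" 1 "\<bar>w * x\<bar>"] by simp
    show "min (6 * x\<^sup>2) (\<bar>w\<bar> * \<bar>x\<bar> ^ 3) \<le> 6 * (x\<^sup>2 * min 1 \<bar>w * x\<bar>)"
      unfolding eq m using nn[of x, unfolded eq] zero_le_power2[of x] by (simp only: min_def split: if_splits) linarith
  qed simp
  finally show ?thesis
    by (simp add: lindeberg_moment_def)
qed

text \<open>
  Near \<open>0\<close> the error of the quadratic approximation is at most half of the quadratic term.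
\<close>

lemma cmod_char_le_exp_near_0:
  assumes "expectation (\<lambda>x. x) = 0" and v: "expectation (\<lambda>x. x\<^sup>2) = v" "0 < v"
  obtains \<epsilon> where "0 < \<epsilon>" "\<And>w. \<bar>w\<bar> \<le> \<epsilon> \<Longrightarrow> cmod (char M w) \<le> exp (- (w\<^sup>2 * v / 4))"
    "\<And>w. \<bar>w\<bar> \<le> \<epsilon> \<Longrightarrow> w\<^sup>2 * v \<le> 1"
proof -
  have "\<forall>\<^sub>F w in at 0. lindeberg_moment M w < v / 4"
    using lindeberg_moment_tendsto_0 v by (intro order_tendstoD) auto
  then obtain d where d: "0 < d" "\<And>w. w \<noteq> 0 \<Longrightarrow> \<bar>w\<bar> < d \<Longrightarrow> lindeberg_moment M w < v / 4"
    by (auto simp: eventually_at)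
  define \<epsilon> where "\<epsilon> = min (d / 2) (1 / sqrt v)"
  have small: "w\<^sup>2 * v \<le> 1" if "\<bar>w\<bar> \<le> \<epsilon>" for w
  proof -
    have "\<bar>w\<bar> \<le> 1 / sqrt v" using that by (simp add: \<epsilon>_def)
    then have "\<bar>w\<bar>\<^sup>2 \<le> (1 / sqrt v)\<^sup>2" by (intro power_mono) auto
    then show ?thesis using v by (simp add: power_divide field_simps)
  qed
  show ?thesis
  proof (rule that[OF _ _ small])
    show "0 < \<epsilon>" using d v by (simp add: \<epsilon>_def)
    fix w assume w: "\<bar>w\<bar> \<le> \<epsilon>"
    show "cmod (char M w) \<le> exp (- (w\<^sup>2 * v / 4))"
    proof (cases "w = 0")
      case True then show ?thesis by (simp add: char_zero)
    next
      case False
      then have l: "lindeberg_moment M w \<le> v / 4"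
        using w d by (intro less_imp_le d(2)) (auto simp: \<epsilon>_def)
      have "cmod (char M w) \<le> cmod (complex_of_real (1 - w\<^sup>2 * v / 2)) + cmod (char M w - complex_of_real (1 - w\<^sup>2 * v / 2))"
        by (rule norm_triangle_sub)
      also have "cmod (char M w - complex_of_real (1 - w\<^sup>2 * v / 2)) \<le> w\<^sup>2 * lindeberg_moment M w"
        using char_quadratic_approx[OF assms(1) v(1), of w] by simp
      also have "\<dots> \<le> w\<^sup>2 * (v / 4)"
        using l by (intro mult_left_mono) auto
      also have "cmod (complex_of_real (1 - w\<^sup>2 * v / 2)) = 1 - w\<^sup>2 * v / 2"
        using small[OF w] unfolding norm_of_real by simp
      also have "1 - w\<^sup>2 * v / 2 + w\<^sup>2 * (v / 4) = 1 + (- (w\<^sup>2 * v / 4))" by simp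
      also have "\<dots> \<le> exp (- (w\<^sup>2 * v / 4))" by (rule exp_ge_add_one_self)
      finally show ?thesis by simp
    qed
  qed
qed

text \<open>
  By Tonelli's theorem the integral over \<open>t\<close> may be taken for each value \<open>x\<close> separately. The frequency \<open>u\<close> enters
  through \<open>ln (\<bar>u * x\<bar> / c)\<close>; bounding the logarithm of \<open>\<bar>u\<bar> / c\<close> by \<open>\<bar>u\<bar> / c\<close> itself is good enough for the later
  integration against a Gaussian weight.
\<close>

lemma nn_integral_lindeberg_moment_le:
  assumes L: "(\<integral>\<^sup>+x. ennreal (x\<^sup>2 * max 0 (ln \<bar>x\<bar>)) \<partial>M) < \<infinity>" and "0 < c"
  obtains A B where "0 \<le> A" "0 \<le> B"
    "\<And>u. (\<integral>\<^sup>+t. ennreal (lindeberg_moment M (u / (c * sqrt t)) / t) * indicator {1..} t \<partial>lborel) \<le> ennreal (A + B * \<bar>u\<bar>)"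
proof -
  interpret P: pair_sigma_finite lborel M ..
  define V where "V = expectation (\<lambda>x. x\<^sup>2)"
  have "0 \<le> V" by (simp add: V_def)
  obtain L' where L': "(\<integral>\<^sup>+x. ennreal (x\<^sup>2 * max 0 (ln \<bar>x\<bar>)) \<partial>M) = ennreal L'" "0 \<le> L'"
    using L by (cases "\<integral>\<^sup>+x. ennreal (x\<^sup>2 * max 0 (ln \<bar>x\<bar>)) \<partial>M") auto
  have V: "(\<integral>\<^sup>+x. ennreal (x\<^sup>2) \<partial>M) = ennreal V"
    using sq by (simp add: V_def nn_integral_eq_integral)
  show ?thesis
  proof (rule that[of "2 * V + 2 * L'" "2 * V / c"])
    fix u :: real
    have "(\<integral>\<^sup>+t. ennreal (lindeberg_moment M (u / (c * sqrt t)) / t) * indicator {1..} t \<partial>lborel)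
       = (\<integral>\<^sup>+t. \<integral>\<^sup>+x. ennreal (x\<^sup>2) * (ennreal (min 1 (\<bar>u * x\<bar> / c / sqrt t) / t) * indicator {1..} t) \<partial>M \<partial>lborel)"
    proof (rule nn_integral_cong)
      fix t :: real
      show "ennreal (lindeberg_moment M (u / (c * sqrt t)) / t) * indicator {1..} t
         = (\<integral>\<^sup>+x. ennreal (x\<^sup>2) * (ennreal (min 1 (\<bar>u * x\<bar> / c / sqrt t) / t) * indicator {1..} t) \<partial>M)"
      proof (cases "1 \<le> t")
        case True
        have "ennreal (lindeberg_moment M (u / (c * sqrt t)) / t)
            = ennreal (\<integral>x. x\<^sup>2 * min 1 \<bar>u / (c * sqrt t) * x\<bar> / t \<partial>M)"
          by (simp add: lindeberg_moment_def)
        also have "\<dots> = (\<integral>\<^sup>+x. ennreal (x\<^sup>2 * min 1 \<bar>u / (c * sqrt t) * x\<bar> / t) \<partial>M)"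
          using integrable_lindeberg[of "u / (c * sqrt t)"] True
          by (intro nn_integral_eq_integral[symmetric]) auto
        also have "\<dots> = (\<integral>\<^sup>+x. ennreal (x\<^sup>2) * ennreal (min 1 (\<bar>u * x\<bar> / c / sqrt t) / t) \<partial>M)"
        proof (rule nn_integral_cong)
          fix x
          have "\<bar>u / (c * sqrt t) * x\<bar> = \<bar>u * x\<bar> / c / sqrt t"
            using \<open>0 < c\<close> True by (simp add: abs_mult abs_divide)
          then show "ennreal (x\<^sup>2 * min 1 \<bar>u / (c * sqrt t) * x\<bar> / t) = ennreal (x\<^sup>2) * ennreal (min 1 (\<bar>u * x\<bar> / c / sqrt t) / t)"
            by (metis ennreal_mult' times_divide_eq_right zero_le_power2)
        qed
        finally show ?thesis using True by simp
      qed simp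
    qed
    also have "\<dots> = (\<integral>\<^sup>+x. \<integral>\<^sup>+t. ennreal (x\<^sup>2) * (ennreal (min 1 (\<bar>u * x\<bar> / c / sqrt t) / t) * indicator {1..} t) \<partial>lborel \<partial>M)"
      by (rule P.Fubini'[symmetric]) simp
    also have "\<dots> \<le> (\<integral>\<^sup>+x. ennreal (x\<^sup>2 * (2 + 2 * \<bar>u\<bar> / c)) + 2 * ennreal (x\<^sup>2 * max 0 (ln \<bar>x\<bar>)) \<partial>M)"
    proof (rule nn_integral_mono)
      fix x :: real
      have "(\<integral>\<^sup>+t. ennreal (x\<^sup>2) * (ennreal (min 1 (\<bar>u * x\<bar> / c / sqrt t) / t) * indicator {1..} t) \<partial>lborel)
         = ennreal (x\<^sup>2) * (\<integral>\<^sup>+t. (ennreal (min 1 (\<bar>u * x\<bar> / c / sqrt t) / t) * indicator {1..} t) \<partial>lborel)"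
        by (rule nn_integral_cmult) simp
      also have "\<dots> \<le> ennreal (x\<^sup>2) * ennreal (2 + 2 * max 0 (ln (\<bar>u * x\<bar> / c)))"
        using \<open>0 < c\<close> by (intro mult_left_mono nn_integral_min_inverse_sqrt_le) auto
      also have "\<dots> = ennreal (x\<^sup>2 * (2 + 2 * max 0 (ln (\<bar>u * x\<bar> / c))))"
        by (simp add: ennreal_mult')
      also have "\<dots> \<le> ennreal (x\<^sup>2 * (2 + 2 * \<bar>u\<bar> / c) + 2 * (x\<^sup>2 * max 0 (ln \<bar>x\<bar>)))"
      proof (rule ennreal_leI)
        have "max 0 (ln (\<bar>u * x\<bar> / c)) \<le> \<bar>u\<bar> / c + max 0 (ln \<bar>x\<bar>)"
          using ln_plus_mult_le[of "\<bar>u\<bar> / c" "\<bar>x\<bar>"] \<open>0 < c\<close> by (simp add: abs_mult)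
        then have "x\<^sup>2 * (2 + 2 * max 0 (ln (\<bar>u * x\<bar> / c))) \<le> x\<^sup>2 * (2 + 2 * (\<bar>u\<bar> / c + max 0 (ln \<bar>x\<bar>)))"
          by (intro mult_left_mono add_left_mono) auto
        then show "x\<^sup>2 * (2 + 2 * max 0 (ln (\<bar>u * x\<bar> / c))) \<le> x\<^sup>2 * (2 + 2 * \<bar>u\<bar> / c) + 2 * (x\<^sup>2 * max 0 (ln \<bar>x\<bar>))"
          by (simp add: algebra_simps)
      qed
      also have "\<dots> = ennreal (x\<^sup>2 * (2 + 2 * \<bar>u\<bar> / c)) + 2 * ennreal (x\<^sup>2 * max 0 (ln \<bar>x\<bar>))"
        using \<open>0 < c\<close> by (simp add: ennreal_mult' ennreal_plus)
      finally show "(\<integral>\<^sup>+t. ennreal (x\<^sup>2) * (ennreal (min 1 (\<bar>u * x\<bar> / c / sqrt t) / t) * indicator {1..} t) \<partial>lborel)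
         \<le> ennreal (x\<^sup>2 * (2 + 2 * \<bar>u\<bar> / c)) + 2 * ennreal (x\<^sup>2 * max 0 (ln \<bar>x\<bar>))" .
    qed
    also have "\<dots> = ennreal V * ennreal (2 + 2 * \<bar>u\<bar> / c) + 2 * ennreal L'"
      unfolding V[symmetric] L'(1)[symmetric] using \<open>0 < c\<close>
      by (simp add: nn_integral_add nn_integral_cmult nn_integral_multc ennreal_mult'')
    also have "\<dots> = ennreal (2 * V + 2 * L' + 2 * V / c * \<bar>u\<bar>)"
      using \<open>0 \<le> V\<close> L'(2) \<open>0 < c\<close>
      by (simp add: ennreal_mult'[symmetric] ennreal_plus[symmetric] algebra_simps del: ennreal_plus flip: ennreal_numeral)
    finally show "(\<integral>\<^sup>+t. ennreal (lindeberg_moment M (u / (c * sqrt t)) / t) * indicator {1..} t \<partial>lborel)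
       \<le> ennreal (2 * V + 2 * L' + 2 * V / c * \<bar>u\<bar>)" .
  qed (use \<open>0 \<le> V\<close> L' \<open>0 < c\<close> in auto)
qed

end

end

section \<open>The log moment implies integrability of the distance\<close>

lemma exp_minus_le_quadratic:
  fixes x :: real
  assumes "0 \<le> x"
  shows "exp (- x) \<le> 1 - x + x\<^sup>2 / 2"
proof -
  have q: "1 + x + x\<^sup>2 / 2 \<le> exp x" "0 < 1 + x + x\<^sup>2 / 2"
    using exp_lower_Taylor_quadratic[OF assms] assms by (auto simp: add_pos_nonneg)
  have pos: "0 \<le> 1 - x + x\<^sup>2 / 2"
    using zero_le_power2[of "x - 1"] by (simp add: power2_eq_square algebra_simps)
  have "1 \<le> (1 - x + x\<^sup>2 / 2) * (1 + x + x\<^sup>2 / 2)"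
    using zero_le_power[of "x\<^sup>2" 2] by (simp add: algebra_simps power2_eq_square)
  also have "\<dots> \<le> (1 - x + x\<^sup>2 / 2) * exp x"
    using q pos by (intro mult_left_mono)
  finally show ?thesis by (simp add: exp_minus field_simps)
qed

lemma integrable_exp_mult_abs_power: "integrable lborel (\<lambda>u::real. exp (- u\<^sup>2 / 8) * \<bar>u\<bar> ^ k)"
proof -
  have "integrable lborel (\<lambda>u. sqrt (8 * pi) * (normal_density 0 2 u * \<bar>u - 0\<bar> ^ k))"
    by (intro integrable_mult_right integrable_normal_moment_abs) simp
  then show ?thesis by (simp add: normal_density_def)
qed

lemma nn_integral_exp_square_div:
  assumes "0 < \<tau>"
  shows "(\<integral>\<^sup>+u. ennreal (exp (- u\<^sup>2 / (2 * \<tau>\<^sup>2))) \<partial>lborel) = ennreal (sqrt (2 * pi) * \<tau>)"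
proof -
  have eq: "exp (- u\<^sup>2 / (2 * \<tau>\<^sup>2)) = sqrt (2 * pi) * \<tau> * normal_density 0 \<tau> u" for u
    using assms by (simp add: normal_density_def real_sqrt_mult)
  have "(\<integral>\<^sup>+u. ennreal (sqrt (2 * pi) * \<tau> * normal_density 0 \<tau> u) \<partial>lborel)
     = ennreal (\<integral>u. sqrt (2 * pi) * \<tau> * normal_density 0 \<tau> u \<partial>lborel)"
    using assms by (intro nn_integral_eq_integral integrable_mult_right) auto
  then show ?thesis using assms unfolding eq by simp
qed

lemma nn_integral_inverse_5_4: "(\<integral>\<^sup>+t. ennreal (1 / (t * sqrt (sqrt t))) * indicator {1..} t \<partial>lborel) = 4"
proof -
  have "(\<integral>\<^sup>+t. ennreal (1 / (t * sqrt (sqrt t))) * indicator {1..} t \<partial>lborel) = ennreal (0 - (- 4 / sqrt (sqrt 1)))"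
  proof (rule nn_integral_FTC_atLeast)
    show "((\<lambda>t. - 4 / sqrt (sqrt t)) \<longlongrightarrow> 0) at_top"
      by (intro tendsto_divide_0[OF tendsto_const] filterlim_at_top_imp_at_infinity
          filterlim_compose[OF sqrt_at_top sqrt_at_top])
    fix t :: real assume t: "1 \<le> t"
    define r where "r = sqrt (sqrt t)"
    have r: "0 < r" "t = r ^ 4" "sqrt t = r ^ 2"
    proof -
      show "0 < r" using t by (simp add: r_def)
      show r2: "sqrt t = r ^ 2" using t by (simp add: r_def)
      have "t = (sqrt t)\<^sup>2" using t by simp
      then show "t = r ^ 4" unfolding r2 by simp
    qed
    have "((\<lambda>t. - 4 / sqrt (sqrt t)) has_real_derivative
        4 * (inverse (sqrt (sqrt t)) / 2 * (inverse (sqrt t) / 2)) / (sqrt (sqrt t))\<^sup>2) (at t)"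
      using t by (auto intro!: derivative_eq_intros simp: power2_eq_square)
    also have "4 * (inverse (sqrt (sqrt t)) / 2 * (inverse (sqrt t) / 2)) / (sqrt (sqrt t))\<^sup>2 = 1 / (t * sqrt (sqrt t))"
      unfolding r_def[symmetric] r(3) using r(1) by (subst r(2)) (simp add: field_simps power2_eq_square power4_eq_xxxx)
    finally show "((\<lambda>t. - 4 / sqrt (sqrt t)) has_real_derivative 1 / (t * sqrt (sqrt t))) (at t)" .
    show "0 \<le> 1 / (t * sqrt (sqrt t))" using t by simp
  qed simp
  then show ?thesis by simp
qed

lemma ennreal_twice_sum:
  assumes "0 \<le> a" "0 \<le> b" "0 \<le> c"
  shows "2 * (I + ennreal a + ennreal b) + ennreal c = 2 * I + ennreal (2 * (a + b) + c)"
proof -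
  have "ennreal (2 * (a + b) + c) = ennreal (2 * (a + b)) + ennreal c"
    using assms by (intro ennreal_plus) auto
  also have "ennreal (2 * (a + b)) = ennreal 2 * ennreal (a + b)"
    using assms by (intro ennreal_mult) auto
  also have "ennreal (a + b) = ennreal a + ennreal b"
    using assms by (intro ennreal_plus)
  finally show ?thesis by (simp add: distrib_left add.assoc)
qed

text \<open>
  The comparison of \<open>\<phi>\<^sub>t = \<phi>\<^sub>1 ^ n * \<phi>\<^sub>s\<close> with the Gaussian, for fixed arguments: here \<open>\<phi>\<close> is
  \<open>\<phi>\<^sub>1(w)\<close>, \<open>\<psi>\<close> is \<open>\<phi>\<^sub>s(w)\<close>, and \<open>v\<close> is \<open>\<sigma>\<^sup>2 * w\<^sup>2\<close>. Telescoping the power loses a factor \<open>n\<close> but keeps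
  \<open>n - 1\<close> factors of modulus at most \<open>exp (- v / 4)\<close>, hence Gaussian decay in \<open>v * t\<close>.
\<close>

lemma cmod_power_mult_minus_exp_le:
  fixes \<phi> \<psi> :: complex and v s t d e :: real
  assumes v: "0 \<le> v" "v \<le> 1" and s: "0 \<le> s" "s \<le> 1" and n: "1 \<le> n" and t: "t = real n + s"
    and \<phi>: "cmod \<phi> \<le> exp (- v / 4)" "cmod (\<phi> - exp (- v / 2)) \<le> d"
    and \<psi>: "cmod \<psi> \<le> 1" "cmod (\<psi> - 1) \<le> e"
  shows "cmod (\<phi> ^ n * \<psi> - exp (- (v * t) / 2)) \<le> exp (- (v * t) / 8) * (2 * t * d + e + v / 2)"
proof -
  define E where "E = exp (- v / 2)"
  define Es where "Es = exp (- (v * s) / 2)"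
  define r where "r = exp (- v / 4)"
  \<comment> \<open>the integer part is at least half of \<open>t\<close>, so \<open>n\<close> may be traded for \<open>t / 2\<close> in the exponents\<close>
  have tn: "t \<le> 2 * real n" using t s n by simp
  have d: "0 \<le> d" using \<phi>(2) norm_ge_zero order_trans by blast
  have e: "0 \<le> e" using \<psi>(2) norm_ge_zero order_trans by blast
  have vt: "v * t \<le> v * (2 * real n)" using tn v by (intro mult_left_mono) auto
  have E: "exp (- (v * t) / 2) = E ^ n * Es"
    unfolding E_def Es_def t by (simp add: exp_of_nat_mult[symmetric] exp_add[symmetric] algebra_simps add_divide_distrib diff_divide_distrib)
  have rn: "r ^ n \<le> exp (- (v * t) / 8)"
    unfolding r_def exp_of_nat_mult[symmetric] using vt by (simp add: mult_ac)
  have En: "E ^ n \<le> exp (- (v * t) / 8)"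
    unfolding E_def exp_of_nat_mult[symmetric] using vt mult_nonneg_nonneg[OF v(1) of_nat_0_le_iff[of n]]
    by (simp add: mult_ac)
  have r2: "1 / r \<le> 2"
  proof -
    have "1 / r = exp (v / 4)" by (simp add: r_def exp_minus field_simps)
    also have "\<dots> \<le> 1 + 2 * (v / 4)"
      using v real_exp_bound_lemma[of "v / 4"] by simp
    finally show ?thesis using v by simp
  qed
  have 1: "cmod (\<phi> ^ n - complex_of_real E ^ n) \<le> exp (- (v * t) / 8) * (2 * t * d)"
  proof -
    have "cmod (\<phi> ^ n - complex_of_real E ^ n) \<le> real n * r ^ n / r * cmod (\<phi> - E)"
      using \<phi>(1) v by (intro norm_power_diff_le) (auto simp: r_def E_def)
    also have "\<dots> \<le> real n * r ^ n / r * d"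
      using \<phi>(2) by (intro mult_left_mono) (auto simp: E_def r_def)
    also have "\<dots> = (real n * d) * (r ^ n * (1 / r))" by simp
    also have "\<dots> \<le> (t * d) * (exp (- (v * t) / 8) * 2)"
      using d s t rn r2 by (intro mult_mono) (auto simp: r_def)
    finally show ?thesis by (simp add: mult_ac)
  qed
  have 2: "cmod (\<psi> - Es) \<le> e + v / 2"
  proof -
    have "1 - v * s / 2 \<le> Es" unfolding Es_def using exp_ge_add_one_self[of "- (v * s) / 2"] by simp
    moreover have "v * s \<le> v" using v s by (simp add: mult_left_le)
    moreover have "Es \<le> 1" unfolding Es_def using v s by simp
    ultimately have "\<bar>1 - Es\<bar> \<le> v / 2" by linarith
    then have "cmod (1 - complex_of_real Es) \<le> v / 2"
      by (metis norm_of_real of_real_1 of_real_diff)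
    then show ?thesis
      using norm_triangle_ineq[of "\<psi> - 1" "1 - complex_of_real Es"] \<psi>(2) by simp
  qed
  have "\<phi> ^ n * \<psi> - exp (- (v * t) / 2) = (\<phi> ^ n - complex_of_real E ^ n) * \<psi> + complex_of_real E ^ n * (\<psi> - Es)"
    unfolding E by (simp add: algebra_simps)
  also have "cmod \<dots> \<le> cmod (\<phi> ^ n - complex_of_real E ^ n) * cmod \<psi> + cmod (complex_of_real E ^ n) * cmod (\<psi> - Es)"
    by (metis norm_mult norm_triangle_ineq)
  also have "\<dots> \<le> exp (- (v * t) / 8) * (2 * t * d) * 1 + exp (- (v * t) / 8) * (e + v / 2)"
  proof (intro add_mono mult_mono 1 2 \<psi>)
    show "cmod (complex_of_real E ^ n) \<le> exp (- (v * t) / 8)"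
      using En by (simp add: norm_power E_def)
  qed (use d s t in auto)
  finally show ?thesis by (simp add: algebra_simps)
qed

locale centered_levy_process = levy_process M X for M :: "'a measure" and X :: "real \<Rightarrow> 'a \<Rightarrow> real" +
  fixes \<sigma> :: real
  assumes integrable_1: "integrable M (X 1)"
    and mean_zero: "expectation (X 1) = 0"
    and square_integrable: "integrable M (\<lambda>\<omega>. (X 1 \<omega>)\<^sup>2)"
    and variance_eq: "expectation (\<lambda>\<omega>. (X 1 \<omega>)\<^sup>2) = \<sigma>\<^sup>2"
    and sigma_pos: "0 < \<sigma>"
begin

sublocale L1: real_distribution "law 1"
  by (rule real_distribution_law) simp

lemma law_1_moments: "L1.expectation (\<lambda>x. x) = 0" "integrable (law 1) (\<lambda>x. x\<^sup>2)" "L1.expectation (\<lambda>x. x\<^sup>2) = \<sigma>\<^sup>2"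
  using mean_zero square_integrable variance_eq random_variable[of 1]
  by (auto simp: integral_distr integrable_distr_eq)

definition scaled_law :: "real \<Rightarrow> real measure" where
  "scaled_law t = distr M borel (\<lambda>\<omega>. X t \<omega> / (\<sigma> * sqrt t))"

lemma real_distribution_scaled_law: "0 \<le> t \<Longrightarrow> real_distribution (scaled_law t)"
  unfolding scaled_law_def
  by (intro real_distribution_distr borel_measurable_divide random_variable) auto

lemma char_scaled_law:
  assumes "0 \<le> t"
  shows "char (scaled_law t) u = char (law t) (u / (\<sigma> * sqrt t))"
proof -
  have [measurable]: "X t \<in> borel_measurable M" using assms by (rule random_variable)
  show ?thesis unfolding char_def scaled_law_def by (simp add: integral_distr)
qed

lemma prob_eq_cdf_scaled_law:
  assumes "0 < t"
  shows "prob {\<omega> \<in> space M. X t \<omega> / sqrt t \<le> x} = cdf (scaled_law t) (x / \<sigma>)"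
proof -
  have [measurable]: "X t \<in> borel_measurable M" using assms by (intro random_variable) simp
  have "cdf (scaled_law t) (x / \<sigma>) = prob ((\<lambda>\<omega>. X t \<omega> / (\<sigma> * sqrt t)) -` {..x / \<sigma>} \<inter> space M)"
    unfolding scaled_law_def cdf_def by (rule measure_distr) auto
  also have "(\<lambda>\<omega>. X t \<omega> / (\<sigma> * sqrt t)) -` {..x / \<sigma>} \<inter> space M = {\<omega> \<in> space M. X t \<omega> / sqrt t \<le> x}"
    using assms sigma_pos by (auto simp: field_simps)
  finally show ?thesis ..
qed

text \<open>
  For small \<open>w\<close> the distance to the Gaussian is the Lindeberg error plus terms of order \<open>1 / sqrt t\<close>. The latter
  come from the error of the linear approximation of \<open>exp (- v / 2)\<close>, where \<open>v = u\<^sup>2 / t\<close>, and from the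
  fractional part \<open>s\<close> of the time, for which the bound \<open>\<bar>\<phi>\<^sub>s(w) - 1\<bar> \<le> C * \<bar>w\<bar>\<close> by first moments suffices.
\<close>

lemma char_scaled_law_approx:
  obtains \<epsilon> K where "0 < \<epsilon>" "0 \<le> K"
    "\<And>t u. 1 \<le> t \<Longrightarrow> \<bar>u / (\<sigma> * sqrt t)\<bar> \<le> \<epsilon> \<Longrightarrow>
      cmod (char (scaled_law t) u - exp (- u\<^sup>2 / 2))
      \<le> exp (- u\<^sup>2 / 8) * (2 * u\<^sup>2 / \<sigma>\<^sup>2 * lindeberg_moment (law 1) (u / (\<sigma> * sqrt t))
          + (u ^ 4 + K * \<bar>u\<bar> + u\<^sup>2) / sqrt t)"
proof -
  obtain \<epsilon> where \<epsilon>: "0 < \<epsilon>" "\<And>w. \<bar>w\<bar> \<le> \<epsilon> \<Longrightarrow> cmod (char (law 1) w) \<le> exp (- (w\<^sup>2 * \<sigma>\<^sup>2 / 4))"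
    "\<And>w. \<bar>w\<bar> \<le> \<epsilon> \<Longrightarrow> w\<^sup>2 * \<sigma>\<^sup>2 \<le> 1"
    using L1.cmod_char_le_exp_near_0[OF law_1_moments(2) law_1_moments(1,3)] sigma_pos by auto
  obtain C where C: "0 \<le> C" "\<And>s. 0 \<le> s \<Longrightarrow> s \<le> 1 \<Longrightarrow> integrable (law s) (\<lambda>x. x)"
    "\<And>s. 0 \<le> s \<Longrightarrow> s \<le> 1 \<Longrightarrow> (\<integral>x. \<bar>x\<bar> \<partial>law s) \<le> C"
    using bounded_first_moment_on_unit_interval[OF integrable_1] by blast
  show ?thesis
  proof (rule that[of \<epsilon> "C / \<sigma>"])
    fix t u :: real assume t: "1 \<le> t" and w: "\<bar>u / (\<sigma> * sqrt t)\<bar> \<le> \<epsilon>"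
    define w where "w = u / (\<sigma> * sqrt t)"
    define n where "n = nat \<lfloor>t\<rfloor>"
    define s where "s = t - real n"
    have n: "1 \<le> n" "0 \<le> s" "s \<le> 1" "t = real n + s"
    proof -
      have "real n = of_int \<lfloor>t\<rfloor>" using t by (simp add: n_def)
      then show "0 \<le> s" "s \<le> 1" unfolding s_def by linarith+
      show "1 \<le> n" using t by (simp add: n_def le_nat_iff)
    qed (simp add: s_def)
    define v where "v = w\<^sup>2 * \<sigma>\<^sup>2"
    have v: "v = u\<^sup>2 / t" "0 \<le> v" "v \<le> 1"
      using t sigma_pos \<epsilon>(3)[of w] w by (auto simp: v_def w_def power_divide power_mult_distrib)
    interpret s: real_distribution "law s" using n(2) by (rule real_distribution_law)
    define \<eta> where "\<eta> = lindeberg_moment (law 1) w"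
    have \<phi>: "cmod (char (law 1) w - exp (- v / 2)) \<le> w\<^sup>2 * \<eta> + v\<^sup>2 / 8"
    proof -
      have "\<bar>exp (- v / 2) - (1 - v / 2)\<bar> \<le> v\<^sup>2 / 8"
        using exp_minus_le_quadratic[of "v / 2"] exp_ge_add_one_self[of "- v / 2"] v
        by (simp add: power_divide)
      then have 1: "cmod (complex_of_real (1 - v / 2) - exp (- v / 2)) \<le> v\<^sup>2 / 8"
        unfolding of_real_diff[symmetric] norm_of_real by (simp only: abs_minus_commute)
      have 2: "cmod (char (law 1) w - complex_of_real (1 - v / 2)) \<le> w\<^sup>2 * \<eta>"
        using L1.char_quadratic_approx[OF law_1_moments(2,1,3), of w] by (simp add: v_def \<eta>_def)
      show ?thesis
        using norm_triangle_ineq[of "char (law 1) w - complex_of_real (1 - v / 2)" "complex_of_real (1 - v / 2) - exp (- v / 2)"] 1 2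
        by simp
    qed
    have \<psi>: "cmod (char (law s) w - 1) \<le> \<bar>w\<bar> * C"
      using s.cmod_char_minus_1_le[OF C(2), of w] mult_left_mono[OF C(3), of s "\<bar>w\<bar>"] n by simp
    have "cmod (char (law 1) w ^ n * char (law s) w - exp (- (v * t) / 2))
       \<le> exp (- (v * t) / 8) * (2 * t * (w\<^sup>2 * \<eta> + v\<^sup>2 / 8) + \<bar>w\<bar> * C + v / 2)"
      using v n \<phi> \<psi> s.cmod_char_le_1 \<epsilon>(2)[of w] w
      by (intro cmod_power_mult_minus_exp_le) (auto simp: v_def w_def)
    moreover have "char (scaled_law t) u = char (law 1) w ^ n * char (law s) w"
    proof -
      have "char (scaled_law t) u = char (law t) w" using t by (simp add: char_scaled_law w_def)
      then show ?thesis by (subst (asm) n(4)) (simp add: char_law_of_nat_add[OF n(2)])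
    qed
    moreover have vt: "v * t = u\<^sup>2" using v(1) t by simp
    ultimately have *: "cmod (char (scaled_law t) u - exp (- u\<^sup>2 / 2))
       \<le> exp (- u\<^sup>2 / 8) * (2 * t * (w\<^sup>2 * \<eta> + v\<^sup>2 / 8) + \<bar>w\<bar> * C + v / 2)"
      by simp
    have sq: "1 / t \<le> 1 / sqrt t"
      using t by (intro divide_left_mono) (auto intro: real_le_lsqrt simp: power2_eq_square)
    have "2 * t * (w\<^sup>2 * \<eta> + v\<^sup>2 / 8) + \<bar>w\<bar> * C + v / 2
       = 2 * u\<^sup>2 / \<sigma>\<^sup>2 * \<eta> + (u ^ 4 / 4 * (1 / t) + C / \<sigma> * \<bar>u\<bar> / sqrt t + u\<^sup>2 / 2 * (1 / t))"
      unfolding v(1) w_def using t sigma_pos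
      by (simp add: abs_mult abs_divide power_divide power_mult_distrib field_simps power2_eq_square power4_eq_xxxx)
    also have "\<dots> \<le> 2 * u\<^sup>2 / \<sigma>\<^sup>2 * \<eta> + (u ^ 4 * (1 / sqrt t) + C / \<sigma> * \<bar>u\<bar> / sqrt t + u\<^sup>2 * (1 / sqrt t))"
      using t by (intro add_left_mono add_mono mult_mono sq order_refl) auto
    also have "\<dots> = 2 * u\<^sup>2 / \<sigma>\<^sup>2 * \<eta> + (u ^ 4 + C / \<sigma> * \<bar>u\<bar> + u\<^sup>2) / sqrt t"
      by (simp add: add_divide_distrib)
    finally have "exp (- u\<^sup>2 / 8) * (2 * t * (w\<^sup>2 * \<eta> + v\<^sup>2 / 8) + \<bar>w\<bar> * C + v / 2)
       \<le> exp (- u\<^sup>2 / 8) * (2 * u\<^sup>2 / \<sigma>\<^sup>2 * \<eta> + (u ^ 4 + C / \<sigma> * \<bar>u\<bar> + u\<^sup>2) / sqrt t)"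
      by (rule mult_left_mono) simp
    with * show "cmod (char (scaled_law t) u - exp (- u\<^sup>2 / 2))
      \<le> exp (- u\<^sup>2 / 8) * (2 * u\<^sup>2 / \<sigma>\<^sup>2 * lindeberg_moment (law 1) (u / (\<sigma> * sqrt t))
          + (u ^ 4 + C / \<sigma> * \<bar>u\<bar> + u\<^sup>2) / sqrt t)"
      unfolding \<eta>_def w_def by linarith
  qed (use \<epsilon>(1) C(1) sigma_pos in auto)
qed

text \<open>
  The smoothing inequality with \<open>h = 1 / sqrt (sqrt t)\<close>. Frequencies with \<open>\<bar>u / (\<sigma> * sqrt t)\<bar> \<le> \<epsilon>\<close> are
  covered by \<open>char_scaled_law_approx\<close>. For the others \<open>1 / \<bar>u\<bar>\<close> is at most of order \<open>1 / sqrt t\<close>, while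
  the Gaussian weight of the smoothing has total mass of order \<open>1 / h\<close>, so that they contribute order \<open>1 / sqrt (sqrt t)\<close> as well.
\<close>

lemma cdf_scaled_law_diff_le:
  obtains Q where "0 \<le> Q"
    "\<And>t x. 1 \<le> t \<Longrightarrow> ennreal \<bar>cdf (scaled_law t) x - cdf std_normal_distribution x\<bar>
      \<le> 2 * (\<integral>\<^sup>+u. ennreal (exp (- u\<^sup>2 / 8) * (2 * \<bar>u\<bar> / \<sigma>\<^sup>2)) * ennreal (lindeberg_moment (law 1) (u / (\<sigma> * sqrt t))) \<partial>lborel)
        + ennreal (Q / sqrt (sqrt t))"
proof -
  obtain \<epsilon> K where \<epsilon>: "0 < \<epsilon>" and K: "0 \<le> K" and inner:
    "\<And>t u. 1 \<le> t \<Longrightarrow> \<bar>u / (\<sigma> * sqrt t)\<bar> \<le> \<epsilon> \<Longrightarrow>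
      cmod (char (scaled_law t) u - exp (- u\<^sup>2 / 2))
      \<le> exp (- u\<^sup>2 / 8) * (2 * u\<^sup>2 / \<sigma>\<^sup>2 * lindeberg_moment (law 1) (u / (\<sigma> * sqrt t))
          + (u ^ 4 + K * \<bar>u\<bar> + u\<^sup>2) / sqrt t)"
    using char_scaled_law_approx by blast
  interpret N: real_distribution std_normal_distribution by (rule real_dist_normal_dist)
  let ?\<eta> = "\<lambda>t u. lindeberg_moment (law 1) (u / (\<sigma> * sqrt t))"
  have \<eta>_nonneg: "0 \<le> ?\<eta> t u" for t u
    by (rule L1.lindeberg_moment_nonneg[OF law_1_moments(2)])
  have \<eta>_meas [measurable]: "lindeberg_moment (law 1) \<in> borel_measurable borel"
    by (rule L1.borel_measurable_lindeberg_moment[OF law_1_moments(2)])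
  let ?p = "\<lambda>u::real. exp (- u\<^sup>2 / 8) * (\<bar>u\<bar> ^ 3 + K + \<bar>u\<bar>)"
  define P where "P = (\<integral>u. ?p u \<partial>lborel)"
  have "integrable lborel (\<lambda>u. exp (- u\<^sup>2 / 8) * \<bar>u\<bar> ^ 3 + K * (exp (- u\<^sup>2 / 8) * \<bar>u\<bar> ^ 0) + exp (- u\<^sup>2 / 8) * \<bar>u\<bar> ^ 1)"
    by (intro Bochner_Integration.integrable_add integrable_mult_right integrable_exp_mult_abs_power)
  also have "(\<lambda>u. exp (- u\<^sup>2 / 8) * \<bar>u\<bar> ^ 3 + K * (exp (- u\<^sup>2 / 8) * \<bar>u\<bar> ^ 0) + exp (- u\<^sup>2 / 8) * \<bar>u\<bar> ^ 1) = ?p"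
    by (simp add: fun_eq_iff algebra_simps)
  finally have "integrable lborel ?p" .
  then have P: "(\<integral>\<^sup>+u. ennreal (?p u) \<partial>lborel) = ennreal P"
    unfolding P_def using K by (intro nn_integral_eq_integral) auto
  have "0 \<le> P" unfolding P_def using K by (intro integral_nonneg_AE) auto
  define c where "c = 2 / (\<epsilon> * \<sigma>)"
  have "0 \<le> c" using \<epsilon> sigma_pos by (simp add: c_def)
  show ?thesis
  proof (rule that[of "2 * (P + c * sqrt (2 * pi)) + 6"])
    show "0 \<le> 2 * (P + c * sqrt (2 * pi)) + 6" using \<open>0 \<le> P\<close> \<open>0 \<le> c\<close> by simp
    fix t x :: real assume t: "1 \<le> t"
    define r where "r = sqrt (sqrt t)"
    have r: "1 \<le> r" "r\<^sup>2 = sqrt t" "sqrt t = r * r" using t by (auto simp: r_def)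
    interpret S: real_distribution "scaled_law t" using t by (intro real_distribution_scaled_law) simp
    have bound: "cmod (char (scaled_law t) u - exp (- u\<^sup>2 / 2)) / \<bar>u\<bar> * exp (- (1 / r * u)\<^sup>2 / 2)
       \<le> exp (- u\<^sup>2 / 8) * (2 * \<bar>u\<bar> / \<sigma>\<^sup>2) * ?\<eta> t u + 1 / sqrt t * ?p u + c / sqrt t * exp (- u\<^sup>2 / (2 * r\<^sup>2))"
      (is "?lhs \<le> ?a + ?b + ?c") for u
    proof -
      have nn: "0 \<le> ?a" "0 \<le> ?b" "0 \<le> ?c"
        using \<eta>_nonneg K t \<open>0 \<le> c\<close> by auto
      show ?thesis
      proof (cases "u = 0")
        case True then show ?thesis using nn by simp
      next
        case u: False
        show ?thesis
        proof (cases "\<bar>u / (\<sigma> * sqrt t)\<bar> \<le> \<epsilon>")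
          case True
          have "?lhs \<le> cmod (char (scaled_law t) u - exp (- u\<^sup>2 / 2)) / \<bar>u\<bar> * 1"
            by (intro mult_left_mono) auto
          also have "\<dots> \<le> exp (- u\<^sup>2 / 8) * (2 * u\<^sup>2 / \<sigma>\<^sup>2 * ?\<eta> t u + (u ^ 4 + K * \<bar>u\<bar> + u\<^sup>2) / sqrt t) / \<bar>u\<bar>"
            using inner[OF t True] by (simp add: divide_right_mono)
          also have "\<dots> = ?a + ?b"
          proof -
            have "u\<^sup>2 = \<bar>u\<bar> * \<bar>u\<bar>" "u ^ 4 = \<bar>u\<bar> * \<bar>u\<bar> ^ 3"
              by (simp_all add: power2_eq_square power4_eq_xxxx power3_eq_cube)
            then show ?thesis using u t sigma_pos by (simp add: field_simps)
          qed
          finally show ?thesis using nn by simp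
        next
          case False
          then have ut: "\<epsilon> * (\<sigma> * sqrt t) \<le> \<bar>u\<bar>"
            using sigma_pos t by (simp add: abs_divide abs_mult field_simps)
          have "cmod (char (scaled_law t) u - exp (- u\<^sup>2 / 2)) \<le> 1 + 1"
            using S.cmod_char_le_1[of u]
            by (intro order_trans[OF norm_triangle_ineq4] add_mono) (auto simp: norm_exp_eq_Re)
          then have "cmod (char (scaled_law t) u - exp (- u\<^sup>2 / 2)) / \<bar>u\<bar> \<le> 2 / (\<epsilon> * (\<sigma> * sqrt t))"
            using ut \<epsilon> sigma_pos t by (intro frac_le) auto
          also have "\<dots> = c / sqrt t" by (simp add: c_def)
          finally have "?lhs \<le> c / sqrt t * exp (- (1 / r * u)\<^sup>2 / 2)"
            by (rule mult_right_mono) simp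
          moreover have "- (1 / r * u)\<^sup>2 / 2 = - u\<^sup>2 / (2 * r\<^sup>2)"
            by (simp add: power_mult_distrib power_divide)
          ultimately have "?lhs \<le> ?c"
            by (simp only:)
          with nn show ?thesis by linarith
        qed
      qed
    qed
    have "ennreal \<bar>cdf (scaled_law t) x - cdf std_normal_distribution x\<bar>
      \<le> 2 * (\<integral>\<^sup>+u. ennreal (cmod (char (scaled_law t) u - exp (- u\<^sup>2 / 2)) / \<bar>u\<bar> * exp (- (1 / r * u)\<^sup>2 / 2)) \<partial>lborel) + ennreal (6 * (1 / r))"
      using r by (intro S.Gaussian_Esseen_inequality) simp
    also have "\<dots> \<le> 2 * (\<integral>\<^sup>+u. ennreal (exp (- u\<^sup>2 / 8) * (2 * \<bar>u\<bar> / \<sigma>\<^sup>2)) * ennreal (?\<eta> t u)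
          + ennreal (1 / sqrt t) * ennreal (?p u) + ennreal (c / sqrt t) * ennreal (exp (- u\<^sup>2 / (2 * r\<^sup>2))) \<partial>lborel) + ennreal (6 * (1 / r))"
    proof (intro add_right_mono mult_left_mono nn_integral_mono)
      fix u :: real
      have "ennreal (cmod (char (scaled_law t) u - exp (- u\<^sup>2 / 2)) / \<bar>u\<bar> * exp (- (1 / r * u)\<^sup>2 / 2))
        \<le> ennreal (exp (- u\<^sup>2 / 8) * (2 * \<bar>u\<bar> / \<sigma>\<^sup>2) * ?\<eta> t u + 1 / sqrt t * ?p u + c / sqrt t * exp (- u\<^sup>2 / (2 * r\<^sup>2)))"
        by (rule ennreal_leI[OF bound])
      also have "\<dots> = ennreal (exp (- u\<^sup>2 / 8) * (2 * \<bar>u\<bar> / \<sigma>\<^sup>2)) * ennreal (?\<eta> t u)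
          + ennreal (1 / sqrt t) * ennreal (?p u) + ennreal (c / sqrt t) * ennreal (exp (- u\<^sup>2 / (2 * r\<^sup>2)))"
        using \<eta>_nonneg K t \<open>0 \<le> c\<close> by (subst (1 2 3) ennreal_mult[symmetric]; simp)
      finally show "ennreal (cmod (char (scaled_law t) u - exp (- u\<^sup>2 / 2)) / \<bar>u\<bar> * exp (- (1 / r * u)\<^sup>2 / 2)) \<le> \<dots>" .
    qed simp
    also have "(\<integral>\<^sup>+u. ennreal (exp (- u\<^sup>2 / 8) * (2 * \<bar>u\<bar> / \<sigma>\<^sup>2)) * ennreal (?\<eta> t u)
          + ennreal (1 / sqrt t) * ennreal (?p u) + ennreal (c / sqrt t) * ennreal (exp (- u\<^sup>2 / (2 * r\<^sup>2))) \<partial>lborel)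
       = (\<integral>\<^sup>+u. ennreal (exp (- u\<^sup>2 / 8) * (2 * \<bar>u\<bar> / \<sigma>\<^sup>2)) * ennreal (?\<eta> t u) \<partial>lborel)
          + ennreal (1 / sqrt t) * ennreal P + ennreal (c / sqrt t) * ennreal (sqrt (2 * pi) * r)"
    proof -
      have "(\<integral>\<^sup>+u. ennreal (exp (- u\<^sup>2 / (2 * r\<^sup>2))) \<partial>lborel) = ennreal (sqrt (2 * pi) * r)"
        using r by (intro nn_integral_exp_square_div) simp
      then show ?thesis unfolding P[symmetric]
        by (subst nn_integral_add, simp, simp)+ (simp add: nn_integral_cmult)
    qed
    also have "2 * (\<dots>) + ennreal (6 * (1 / r))
       = 2 * (\<integral>\<^sup>+u. ennreal (exp (- u\<^sup>2 / 8) * (2 * \<bar>u\<bar> / \<sigma>\<^sup>2)) * ennreal (?\<eta> t u) \<partial>lborel)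
          + ennreal (2 * (1 / sqrt t * P + c / sqrt t * (sqrt (2 * pi) * r)) + 6 * (1 / r))"
    proof -
      have "ennreal (1 / sqrt t) * ennreal P = ennreal (1 / sqrt t * P)"
        "ennreal (c / sqrt t) * ennreal (sqrt (2 * pi) * r) = ennreal (c / sqrt t * (sqrt (2 * pi) * r))"
        using t r \<open>0 \<le> P\<close> \<open>0 \<le> c\<close> by (rule_tac [!] ennreal_mult[symmetric]) auto
      then show ?thesis
        using t r \<open>0 \<le> P\<close> \<open>0 \<le> c\<close> by (simp only:) (intro ennreal_twice_sum; simp)
    qed
    also have "\<dots> \<le> 2 * (\<integral>\<^sup>+u. ennreal (exp (- u\<^sup>2 / 8) * (2 * \<bar>u\<bar> / \<sigma>\<^sup>2)) * ennreal (?\<eta> t u) \<partial>lborel)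
          + ennreal ((2 * (P + c * sqrt (2 * pi)) + 6) / r)"
    proof (intro add_left_mono ennreal_leI)
      have "1 / sqrt t * P \<le> P / r"
        unfolding r(3) using r(1) \<open>0 \<le> P\<close> mult_left_mono[of 1 r P] by (simp add: field_simps)
      moreover have "c / sqrt t * (sqrt (2 * pi) * r) = c * sqrt (2 * pi) / r"
        unfolding r(3) using r(1) by simp
      ultimately show "2 * (1 / sqrt t * P + c / sqrt t * (sqrt (2 * pi) * r)) + 6 * (1 / r) \<le> (2 * (P + c * sqrt (2 * pi)) + 6) / r"
        by (simp add: add_divide_distrib distrib_left)
    qed
    finally show "ennreal \<bar>cdf (scaled_law t) x - cdf std_normal_distribution x\<bar>
      \<le> 2 * (\<integral>\<^sup>+u. ennreal (exp (- u\<^sup>2 / 8) * (2 * \<bar>u\<bar> / \<sigma>\<^sup>2)) * ennreal (?\<eta> t u) \<partial>lborel)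
        + ennreal ((2 * (P + c * sqrt (2 * pi)) + 6) / sqrt (sqrt t))"
      unfolding r_def .
  qed
qed

theorem Kolmogorov_distance_integrable:
  assumes L: "(\<integral>\<^sup>+\<omega>. ennreal ((X 1 \<omega>)\<^sup>2 * max 0 (ln \<bar>X 1 \<omega>\<bar>)) \<partial>M) < \<infinity>"
  shows "(\<integral>\<^sup>+t\<in>{1..}. (SUP x. ennreal \<bar>prob {\<omega> \<in> space M. X t \<omega> / sqrt t \<le> x} - std_normal_cdf (x / \<sigma>)\<bar>) / ennreal t \<partial>lborel) < \<infinity>"
proof -
  have "(\<integral>\<^sup>+x. ennreal (x\<^sup>2 * max 0 (ln \<bar>x\<bar>)) \<partial>law 1) < \<infinity>"
    using L random_variable[of 1] by (simp add: nn_integral_distr)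
  then obtain A B where AB: "0 \<le> A" "0 \<le> B" and \<eta>:
    "\<And>u. (\<integral>\<^sup>+t. ennreal (lindeberg_moment (law 1) (u / (\<sigma> * sqrt t)) / t) * indicator {1..} t \<partial>lborel) \<le> ennreal (A + B * \<bar>u\<bar>)"
    using L1.nn_integral_lindeberg_moment_le[OF law_1_moments(2) _ sigma_pos] by blast
  obtain Q where Q: "0 \<le> Q" and bound:
    "\<And>t x. 1 \<le> t \<Longrightarrow> ennreal \<bar>cdf (scaled_law t) x - cdf std_normal_distribution x\<bar>
      \<le> 2 * (\<integral>\<^sup>+u. ennreal (exp (- u\<^sup>2 / 8) * (2 * \<bar>u\<bar> / \<sigma>\<^sup>2)) * ennreal (lindeberg_moment (law 1) (u / (\<sigma> * sqrt t))) \<partial>lborel)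
        + ennreal (Q / sqrt (sqrt t))"
    using cdf_scaled_law_diff_le by blast
  have [measurable]: "lindeberg_moment (law 1) \<in> borel_measurable borel"
    by (rule L1.borel_measurable_lindeberg_moment[OF law_1_moments(2)])
  let ?g = "\<lambda>u::real. ennreal (exp (- u\<^sup>2 / 8) * (2 * \<bar>u\<bar> / \<sigma>\<^sup>2))"
  let ?\<eta> = "\<lambda>t u. lindeberg_moment (law 1) (u / (\<sigma> * sqrt t))"
  have "(\<integral>\<^sup>+t\<in>{1..}. (SUP x. ennreal \<bar>prob {\<omega> \<in> space M. X t \<omega> / sqrt t \<le> x} - std_normal_cdf (x / \<sigma>)\<bar>) / ennreal t \<partial>lborel)
     \<le> (\<integral>\<^sup>+t. 2 * (\<integral>\<^sup>+u. ?g u * (ennreal (?\<eta> t u / t) * indicator {1..} t) \<partial>lborel)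
          + ennreal Q * (ennreal (1 / (t * sqrt (sqrt t))) * indicator {1..} t) \<partial>lborel)"
  proof (rule nn_integral_mono)
    fix t :: real
    let ?S = "SUP x. ennreal \<bar>prob {\<omega> \<in> space M. X t \<omega> / sqrt t \<le> x} - std_normal_cdf (x / \<sigma>)\<bar>"
    show "?S / ennreal t * indicator {1..} t
      \<le> 2 * (\<integral>\<^sup>+u. ?g u * (ennreal (?\<eta> t u / t) * indicator {1..} t) \<partial>lborel)
          + ennreal Q * (ennreal (1 / (t * sqrt (sqrt t))) * indicator {1..} t)"
    proof (cases "1 \<le> t")
      case t: True
      have "?S \<le> 2 * (\<integral>\<^sup>+u. ?g u * ennreal (?\<eta> t u) \<partial>lborel) + ennreal (Q / sqrt (sqrt t))"
        using t by (intro SUP_least) (simp only: prob_eq_cdf_scaled_law std_normal_cdf_eq_cdf bound)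
      then have "?S / ennreal t \<le> (2 * (\<integral>\<^sup>+u. ?g u * ennreal (?\<eta> t u) \<partial>lborel) + ennreal (Q / sqrt (sqrt t))) / ennreal t"
        by (rule divide_right_mono_ennreal)
      also have "\<dots> = (2 * (\<integral>\<^sup>+u. ?g u * ennreal (?\<eta> t u) \<partial>lborel) + ennreal (Q / sqrt (sqrt t))) * ennreal (1 / t)"
        using t by (simp add: divide_ennreal_def inverse_ennreal inverse_eq_divide)
      also have "\<dots> = 2 * ((\<integral>\<^sup>+u. ?g u * ennreal (?\<eta> t u) \<partial>lborel) * ennreal (1 / t)) + ennreal (Q / sqrt (sqrt t)) * ennreal (1 / t)"
        by (simp only: distrib_right mult.assoc)
      also have "(\<integral>\<^sup>+u. ?g u * ennreal (?\<eta> t u) \<partial>lborel) * ennreal (1 / t) = (\<integral>\<^sup>+u. ?g u * ennreal (?\<eta> t u) * ennreal (1 / t) \<partial>lborel)"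
        by (rule nn_integral_multc[symmetric]) simp
      also have "2 * (\<integral>\<^sup>+u. ?g u * ennreal (?\<eta> t u) * ennreal (1 / t) \<partial>lborel) + ennreal (Q / sqrt (sqrt t)) * ennreal (1 / t)
         = 2 * (\<integral>\<^sup>+u. ?g u * ennreal (?\<eta> t u / t) \<partial>lborel) + ennreal Q * ennreal (1 / (t * sqrt (sqrt t)))"
        using t Q by (simp add: mult.assoc ennreal_mult''[symmetric] ennreal_mult'[symmetric])
      finally show ?thesis using t by simp
    qed simp
  qed
  also have "\<dots> = 2 * (\<integral>\<^sup>+t. \<integral>\<^sup>+u. ?g u * (ennreal (?\<eta> t u / t) * indicator {1..} t) \<partial>lborel \<partial>lborel) + ennreal Q * 4"
    unfolding nn_integral_inverse_5_4[symmetric] by (simp add: nn_integral_add nn_integral_cmult)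
  finally have main: "(\<integral>\<^sup>+t\<in>{1..}. (SUP x. ennreal \<bar>prob {\<omega> \<in> space M. X t \<omega> / sqrt t \<le> x} - std_normal_cdf (x / \<sigma>)\<bar>) / ennreal t \<partial>lborel)
     \<le> \<dots>" .
  have "(\<integral>\<^sup>+t. \<integral>\<^sup>+u. ?g u * (ennreal (?\<eta> t u / t) * indicator {1..} t) \<partial>lborel \<partial>lborel)
     = (\<integral>\<^sup>+u. \<integral>\<^sup>+t. ?g u * (ennreal (?\<eta> t u / t) * indicator {1..} t) \<partial>lborel \<partial>lborel)"
    by (rule lborel_pair.Fubini'[symmetric]) simp
  also have "\<dots> \<le> (\<integral>\<^sup>+u. ennreal (exp (- u\<^sup>2 / 8) * (2 * \<bar>u\<bar> / \<sigma>\<^sup>2) * (A + B * \<bar>u\<bar>)) \<partial>lborel)"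
  proof (rule nn_integral_mono)
    fix u :: real
    have "(\<integral>\<^sup>+t. ?g u * (ennreal (?\<eta> t u / t) * indicator {1..} t) \<partial>lborel)
       = ?g u * (\<integral>\<^sup>+t. ennreal (?\<eta> t u / t) * indicator {1..} t \<partial>lborel)"
      by (rule nn_integral_cmult) simp
    also have "\<dots> \<le> ?g u * ennreal (A + B * \<bar>u\<bar>)"
      by (intro mult_left_mono \<eta>) simp
    also have "\<dots> = ennreal (exp (- u\<^sup>2 / 8) * (2 * \<bar>u\<bar> / \<sigma>\<^sup>2) * (A + B * \<bar>u\<bar>))"
      using AB by (intro ennreal_mult[symmetric]) auto
    finally show "(\<integral>\<^sup>+t. ?g u * (ennreal (?\<eta> t u / t) * indicator {1..} t) \<partial>lborel) \<le> \<dots>" .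
  qed
  also have "\<dots> < \<infinity>"
  proof -
    have "integrable lborel (\<lambda>u. (2 * A / \<sigma>\<^sup>2) * (exp (- u\<^sup>2 / 8) * \<bar>u\<bar> ^ 1) + (2 * B / \<sigma>\<^sup>2) * (exp (- u\<^sup>2 / 8) * \<bar>u\<bar> ^ 2))"
      by (intro Bochner_Integration.integrable_add integrable_mult_right integrable_exp_mult_abs_power)
    also have "(\<lambda>u::real. (2 * A / \<sigma>\<^sup>2) * (exp (- u\<^sup>2 / 8) * \<bar>u\<bar> ^ 1) + (2 * B / \<sigma>\<^sup>2) * (exp (- u\<^sup>2 / 8) * \<bar>u\<bar> ^ 2))
       = (\<lambda>u. exp (- u\<^sup>2 / 8) * (2 * \<bar>u\<bar> / \<sigma>\<^sup>2) * (A + B * \<bar>u\<bar>))"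
      by (simp add: fun_eq_iff algebra_simps add_divide_distrib power2_eq_square[of "\<bar>_\<bar>"] del: power2_abs abs_mult_self_eq)
    finally have "integrable lborel (\<lambda>u. exp (- u\<^sup>2 / 8) * (2 * \<bar>u\<bar> / \<sigma>\<^sup>2) * (A + B * \<bar>u\<bar>))" .
    from nn_integral_eq_integral[OF this] AB show ?thesis by simp
  qed
  finally have "(\<integral>\<^sup>+t. \<integral>\<^sup>+u. ?g u * (ennreal (?\<eta> t u / t) * indicator {1..} t) \<partial>lborel \<partial>lborel) < \<infinity>" .
  then have "2 * (\<integral>\<^sup>+t. \<integral>\<^sup>+u. ?g u * (ennreal (?\<eta> t u / t) * indicator {1..} t) \<partial>lborel \<partial>lborel) + ennreal Q * 4 < \<infinity>"
    by (simp add: ennreal_mult_less_top)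
  with main show ?thesis by (rule le_less_trans)
qed

end

section \<open>Integrability of the distance implies the log moment\<close>

lemma one_minus_cos_le:
  fixes x :: real
  shows "1 - x\<^sup>2 / 2 \<le> cos x"
proof -
  have "\<bar>Re (iexp x - (1 + \<i> * x))\<bar> \<le> x\<^sup>2 / 2"
    using iexp_approx1[of x 1] by (intro order_trans[OF abs_Re_le_cmod]) (simp add: power2_eq_square)
  then show ?thesis by (simp add: Re_exp abs_le_iff)
qed

definition cos_remainder :: "real \<Rightarrow> real" where
  "cos_remainder x = cos x - 1 + x\<^sup>2 / 2"

lemma cos_remainder_nonneg: "0 \<le> cos_remainder x"
  using one_minus_cos_le[of x] by (simp add: cos_remainder_def)

lemma cos_remainder_le: "cos_remainder x \<le> x\<^sup>2 / 2"
  by (simp add: cos_remainder_def)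

lemma borel_measurable_cos_remainder [measurable]: "cos_remainder \<in> borel_measurable borel"
  unfolding cos_remainder_def by measurable

text \<open>
  The lower bound for the integral of \<open>cos_remainder (x / sqrt t)\<close> over \<open>t \<ge> 1\<close>; it has the growth of
  \<open>x\<^sup>2 * ln \<bar>x\<bar>\<close>, and in this form it is monotone in \<open>\<bar>x\<bar>\<close>.
\<close>

definition square_log :: "real \<Rightarrow> real" where
  "square_log x = x\<^sup>2 / 4 * max 0 (ln (x\<^sup>2 / 8))"

lemma square_log_nonneg: "0 \<le> square_log x"
  by (simp add: square_log_def)

lemma borel_measurable_square_log [measurable]: "square_log \<in> borel_measurable borel"
  unfolding square_log_def by measurable

lemma max_0_ln_mono:
  fixes a b :: real
  assumes "0 \<le> a" "a \<le> b"
  shows "max 0 (ln a) \<le> max 0 (ln b)"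
  using assms by (cases "a = 0") (auto intro: max.coboundedI2)

lemma square_log_mono:
  assumes "\<bar>x\<bar> \<le> \<bar>y\<bar>"
  shows "square_log x \<le> square_log y"
proof -
  have "x\<^sup>2 \<le> y\<^sup>2" using assms by (simp add: abs_le_square_iff)
  then show ?thesis
    unfolding square_log_def by (intro mult_mono max_0_ln_mono) auto
qed

text \<open>
  A log moment is not affected by centring and scaling: beyond \<open>T\<close> the shift by \<open>a\<close> at most halves \<open>\<bar>x\<bar>\<close>, and \<open>\<bar>x\<bar>\<close>
  is so large that the factor \<open>1 / (32 * \<sigma>\<^sup>2)\<close> inside the logarithm costs at most one of the two powers of \<open>\<bar>x\<bar>\<close>.
\<close>

lemma square_mult_ln_le_square_log:
  fixes a x \<sigma> :: real
  assumes "0 < \<sigma>"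
  defines "T \<equiv> max (2 * \<bar>a\<bar>) (32 * \<sigma>\<^sup>2)"
  shows "x\<^sup>2 * max 0 (ln \<bar>x\<bar>) \<le> T\<^sup>2 * max 0 (ln T) + 16 * \<sigma>\<^sup>2 * square_log ((a - x) / \<sigma>)"
proof (cases "\<bar>x\<bar> \<le> T")
  case True
  then have "\<bar>x\<bar>\<^sup>2 \<le> T\<^sup>2" by (intro power_mono) auto
  then have "x\<^sup>2 * max 0 (ln \<bar>x\<bar>) \<le> T\<^sup>2 * max 0 (ln T)"
    using True by (intro mult_mono max_0_ln_mono) auto
  then show ?thesis
    using square_log_nonneg[of "(a - x) / \<sigma>"] by (intro add_increasing2) auto
next
  case False
  then have x: "2 * \<bar>a\<bar> \<le> \<bar>x\<bar>" "32 * \<sigma>\<^sup>2 \<le> \<bar>x\<bar>" by (auto simp: T_def)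
  have "\<bar>x / (2 * \<sigma>)\<bar> \<le> \<bar>(a - x) / \<sigma>\<bar>"
  proof -
    have "\<bar>x\<bar> / 2 \<le> \<bar>a - x\<bar>" using x(1) by linarith
    then have "\<bar>x\<bar> / 2 / \<sigma> \<le> \<bar>a - x\<bar> / \<sigma>" using assms(1) by (intro divide_right_mono) auto
    then show ?thesis using assms(1) by (simp add: abs_divide abs_mult)
  qed
  then have "square_log (x / (2 * \<sigma>)) \<le> square_log ((a - x) / \<sigma>)" by (rule square_log_mono)
  moreover have "x\<^sup>2 / (16 * \<sigma>\<^sup>2) * max 0 (ln \<bar>x\<bar>) \<le> square_log (x / (2 * \<sigma>))"
  proof -
    have "\<bar>x\<bar> * (32 * \<sigma>\<^sup>2) \<le> \<bar>x\<bar> * \<bar>x\<bar>" using x(2) by (intro mult_left_mono) auto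
    then have "\<bar>x\<bar> \<le> x\<^sup>2 / (32 * \<sigma>\<^sup>2)"
      using assms(1) by (simp add: field_simps power2_eq_square)
    then have "max 0 (ln \<bar>x\<bar>) \<le> max 0 (ln (x\<^sup>2 / (32 * \<sigma>\<^sup>2)))"
      by (intro max_0_ln_mono) auto
    then show ?thesis
      unfolding square_log_def by (simp add: power_divide power_mult_distrib mult_left_mono divide_right_mono)
  qed
  ultimately have "x\<^sup>2 / (16 * \<sigma>\<^sup>2) * max 0 (ln \<bar>x\<bar>) \<le> square_log ((a - x) / \<sigma>)" by linarith
  then have "x\<^sup>2 * max 0 (ln \<bar>x\<bar>) \<le> 16 * \<sigma>\<^sup>2 * square_log ((a - x) / \<sigma>)"
    using assms(1) by (simp add: field_simps)
  then show ?thesis by (intro add_increasing) auto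
qed

text \<open>
  The source of the logarithm in the lower bound: while \<open>8 * t \<le> x\<^sup>2\<close> the term \<open>cos - 1\<close>
  costs at most half of the quadratic term, and the remainder is at least \<open>x\<^sup>2 / (4 * t)\<close>.
\<close>

lemma nn_integral_cos_remainder_ge:
  "ennreal (square_log x) \<le> (\<integral>\<^sup>+t. ennreal (cos_remainder (x / sqrt t)) * indicator {1..} t \<partial>lborel)"
proof (cases "8 \<le> x\<^sup>2")
  case True
  define m where "m = x\<^sup>2 / 8"
  have m: "1 \<le> m" using True by (simp add: m_def)
  have "ennreal (square_log x) = ennreal (x\<^sup>2 / 4) * ennreal (ln m - ln 1)"
    using m by (simp add: square_log_def m_def[symmetric] ennreal_mult'[symmetric])
  also have "ennreal (ln m - ln 1) = (\<integral>\<^sup>+t. ennreal (1 / t) * indicator {1..m} t \<partial>lborel)"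
    using m by (intro nn_integral_FTC_Icc[symmetric]) (auto intro!: derivative_eq_intros)
  also have "ennreal (x\<^sup>2 / 4) * \<dots> = (\<integral>\<^sup>+t. ennreal (x\<^sup>2 / 4) * (ennreal (1 / t) * indicator {1..m} t) \<partial>lborel)"
    by (rule nn_integral_cmult[symmetric]) simp
  also have "\<dots> \<le> (\<integral>\<^sup>+t. ennreal (cos_remainder (x / sqrt t)) * indicator {1..} t \<partial>lborel)"
  proof (rule nn_integral_mono)
    fix t :: real
    show "ennreal (x\<^sup>2 / 4) * (ennreal (1 / t) * indicator {1..m} t) \<le> ennreal (cos_remainder (x / sqrt t)) * indicator {1..} t"
    proof (cases "t \<in> {1..m}")
      case True
      then have sq: "(x / sqrt t)\<^sup>2 = x\<^sup>2 / t" "8 \<le> x\<^sup>2 / t"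
        by (auto simp: power_divide m_def field_simps)
      have "x\<^sup>2 / 4 * (1 / t) \<le> cos_remainder (x / sqrt t)"
      proof -
        define q where "q = x\<^sup>2 / t"
        have "x\<^sup>2 / 4 * (1 / t) = q / 4" "(x / sqrt t)\<^sup>2 = q" "8 \<le> q"
          using sq by (simp_all add: q_def)
        then show ?thesis
          using cos_ge_minus_one[of "x / sqrt t"] by (simp only: cos_remainder_def)
      qed
      then show ?thesis using True by (auto simp: ennreal_mult'[symmetric] intro: ennreal_leI)
    qed simp
  qed
  finally show ?thesis .
next
  case False
  then have "square_log x = 0" by (cases "x = 0") (auto simp: square_log_def)
  then show ?thesis by simp
qed

lemma Bernoulli_tangent_bound:
  fixes a b :: real
  assumes "0 \<le> a" "0 < b" "1 \<le> k"
  shows "b ^ k + real k * b ^ (k - 1) * (a - b) \<le> a ^ k"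
proof -
  have "1 + real k * (a / b - 1) \<le> (1 + (a / b - 1)) ^ k"
    using assms by (intro Bernoulli_inequality) simp
  then have "b ^ k * (1 + real k * (a / b - 1)) \<le> b ^ k * (a / b) ^ k"
    using assms by (intro mult_left_mono) auto
  moreover have "b ^ k * (a / b) ^ k = a ^ k"
    using assms by (simp add: power_divide)
  moreover obtain j where "k = Suc j" using assms(3) by (cases k) auto
  then have "b ^ k * (1 + real k * (a / b - 1)) = b ^ k + real k * b ^ (k - 1) * (a - b)"
    using assms by (simp add: field_simps)
  ultimately show ?thesis by simp
qed

text \<open>
  The amount by which the characteristic function of the symmetrised law, \<open>\<bar>char M w\<bar>\<^sup>2\<close>, exceeds its quadratic
  approximation; see \<open>cmod_char_square\<close>.
\<close>

definition (in real_distribution) char_excess :: "real \<Rightarrow> real" where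
  "char_excess w = (\<integral>y. cos_remainder (w * y) \<partial>symmetrization M)"

context real_distribution
begin

interpretation S: real_distribution "symmetrization M"
  by (rule real_distribution_symmetrization)

lemma symmetrization_moments:
  assumes "integrable M (\<lambda>x. x\<^sup>2)" "expectation (\<lambda>x. x) = 0"
  shows "integrable (symmetrization M) (\<lambda>x. x\<^sup>2)"
    "S.expectation (\<lambda>x. x\<^sup>2) = 2 * expectation (\<lambda>x. x\<^sup>2)"
proof -
  interpret P: pair_prob_space M M ..
  have i1: "integrable M (\<lambda>x. x)"
    using assms(1) by (rule square_integrable_imp_integrable[rotated]) simp
  have prod: "integrable (M \<Otimes>\<^sub>M M) (\<lambda>p. f (fst p) * g (snd p))"
    if f: "integrable M f" and g: "integrable M g" for f g :: "real \<Rightarrow> real"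
  proof (rule P.Fubini_integrable)
    have [measurable]: "f \<in> borel_measurable M" "g \<in> borel_measurable M" using f g by auto
    show "(\<lambda>p. f (fst p) * g (snd p)) \<in> borel_measurable (M \<Otimes>\<^sub>M M)" by measurable
    show "integrable M (\<lambda>x. \<integral>y. norm (f (fst (x, y)) * g (snd (x, y))) \<partial>M)"
      using f by (simp add: abs_mult)
    show "AE x in M. integrable M (\<lambda>y. f (fst (x, y)) * g (snd (x, y)))"
      using g by simp
  qed
  have f: "integrable (M \<Otimes>\<^sub>M M) (\<lambda>p. (fst p)\<^sup>2)" "integrable (M \<Otimes>\<^sub>M M) (\<lambda>p. (snd p)\<^sup>2)"
    "integrable (M \<Otimes>\<^sub>M M) (\<lambda>p. fst p * snd p)"
    using prod[OF assms(1), of "\<lambda>_. 1"] prod[of "\<lambda>_. 1", OF _ assms(1)] prod[OF i1 i1] by simp_all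
  have eq: "(fst p - snd p)\<^sup>2 = (fst p)\<^sup>2 + (snd p)\<^sup>2 - 2 * (fst p * snd p)" for p :: "real \<times> real"
    by (simp add: power2_eq_square algebra_simps)
  have "integrable (M \<Otimes>\<^sub>M M) (\<lambda>p. (fst p - snd p)\<^sup>2)"
    unfolding eq using f by simp
  then show "integrable (symmetrization M) (\<lambda>x. x\<^sup>2)"
    unfolding symmetrization_def by (subst integrable_distr_eq) (auto simp: split_beta)
  have "S.expectation (\<lambda>x. x\<^sup>2) = (\<integral>p. (fst p - snd p)\<^sup>2 \<partial>(M \<Otimes>\<^sub>M M))"
    unfolding symmetrization_def by (subst integral_distr) (auto simp: split_beta)
  also have "\<dots> = (\<integral>p. (fst p)\<^sup>2 \<partial>(M \<Otimes>\<^sub>M M)) + (\<integral>p. (snd p)\<^sup>2 \<partial>(M \<Otimes>\<^sub>M M)) - 2 * (\<integral>p. fst p * snd p \<partial>(M \<Otimes>\<^sub>M M))"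
    unfolding eq using f by simp
  also have "(\<integral>p. (fst p)\<^sup>2 \<partial>(M \<Otimes>\<^sub>M M)) = expectation (\<lambda>x. x\<^sup>2)"
    using P.integral_fst'[OF f(1)] prob_space by simp
  also have "(\<integral>p. (snd p)\<^sup>2 \<partial>(M \<Otimes>\<^sub>M M)) = expectation (\<lambda>x. x\<^sup>2)"
    using P.integral_fst'[OF f(2)] prob_space by simp
  also have "(\<integral>p. fst p * snd p \<partial>(M \<Otimes>\<^sub>M M)) = 0"
    using P.integral_fst'[OF f(3)] assms(2) by simp
  finally show "S.expectation (\<lambda>x. x\<^sup>2) = 2 * expectation (\<lambda>x. x\<^sup>2)" by simp
qed

context
  assumes sq: "integrable M (\<lambda>x. x\<^sup>2)" and mean: "expectation (\<lambda>x. x) = 0"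
begin

lemma integrable_cos_remainder_symmetrization:
  "integrable (symmetrization M) (\<lambda>y. cos_remainder (w * y))"
proof (rule Bochner_Integration.integrable_bound)
  show "integrable (symmetrization M) (\<lambda>y. w\<^sup>2 / 2 * y\<^sup>2)"
    using symmetrization_moments(1)[OF sq mean] by simp
  show "AE y in symmetrization M. norm (cos_remainder (w * y)) \<le> norm (w\<^sup>2 / 2 * y\<^sup>2)"
  proof (intro AE_I2)
    fix y
    show "norm (cos_remainder (w * y)) \<le> norm (w\<^sup>2 / 2 * y\<^sup>2)"
      using cos_remainder_nonneg[of "w * y"] cos_remainder_le[of "w * y"] by (simp add: power_mult_distrib)
  qed
qed simp

lemma char_excess_nonneg: "0 \<le> char_excess w"
  unfolding char_excess_def using cos_remainder_nonneg by (intro integral_nonneg_AE) auto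

lemma cmod_char_square: "(cmod (char M w))\<^sup>2 = 1 - w\<^sup>2 * expectation (\<lambda>x. x\<^sup>2) + char_excess w"
proof -
  have int: "integrable (symmetrization M) (\<lambda>y. iexp (w * y))"
    by (intro S.integrable_const_bound[where B=1]) auto
  have ci: "integrable (symmetrization M) (\<lambda>y. cos (w * y))"
    by (intro S.integrable_const_bound[where B=1]) auto
  have "(cmod (char M w))\<^sup>2 = Re (char (symmetrization M) w)"
    by (simp add: char_symmetrization)
  also have "\<dots> = S.expectation (\<lambda>y. cos (w * y))"
    using int unfolding char_def by (subst integral_Re[symmetric]) (auto simp: Re_exp)
  finally have 1: "(cmod (char M w))\<^sup>2 = S.expectation (\<lambda>y. cos (w * y))" .
  have "char_excess w = S.expectation (\<lambda>y. cos (w * y) - 1 + w\<^sup>2 / 2 * y\<^sup>2)"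
    by (simp add: char_excess_def cos_remainder_def power_mult_distrib)
  also have "\<dots> = S.expectation (\<lambda>y. cos (w * y)) - 1 + w\<^sup>2 / 2 * S.expectation (\<lambda>x. x\<^sup>2)"
    using ci symmetrization_moments(1)[OF sq mean] S.prob_space by simp
  finally show ?thesis
    using 1 symmetrization_moments(2)[OF sq mean] by simp
qed

lemma borel_measurable_char_excess [measurable]: "char_excess \<in> borel_measurable borel"
proof -
  have "char_excess = (\<lambda>w. (cmod (char M w))\<^sup>2 - 1 + w\<^sup>2 * expectation (\<lambda>x. x\<^sup>2))"
    by (rule ext) (simp add: cmod_char_square)
  then show ?thesis by simp
qed

end

end

context centered_levy_process
begin

text \<open>
  With \<open>a = \<bar>\<phi>\<^sub>1(w)\<bar>\<^sup>2\<close>, the squared modulus is at least \<open>a ^ (n + 1)\<close>. The tangent to the power at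
  \<open>b = exp (- u\<^sup>2 / t)\<close> bounds this from below, linearly in the excess of \<open>a\<close> over the quadratic approximation, with slope at least \<open>t * exp (- u\<^sup>2)\<close>.
  The price of \<open>n + 1\<close> instead of \<open>t\<close> and of the quadratic error of \<open>b\<close> is of order \<open>1 / t\<close>.
\<close>

lemma cmod_char_scaled_law_ge:
  assumes t: "1 \<le> t"
  shows "t * (exp (- u\<^sup>2) * L1.char_excess (u / (\<sigma> * sqrt t))) - (u\<^sup>2 + u ^ 4) / t
    \<le> (cmod (char (scaled_law t) u))\<^sup>2 - exp (- u\<^sup>2)"
proof -
  define w where "w = u / (\<sigma> * sqrt t)"
  define n where "n = nat \<lfloor>t\<rfloor>"
  define s where "s = t - real n"
  have n: "1 \<le> n" "0 \<le> s" "s \<le> 1" "t = real n + s"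
  proof -
    have "real n = of_int \<lfloor>t\<rfloor>" using t by (simp add: n_def)
    then show "0 \<le> s" "s \<le> 1" unfolding s_def by linarith+
    show "1 \<le> n" using t by (simp add: n_def le_nat_iff)
  qed (simp add: s_def)
  define v where "v = w\<^sup>2 * \<sigma>\<^sup>2"
  have v: "v = u\<^sup>2 / t" "0 \<le> v" "v * t = u\<^sup>2"
    using t sigma_pos by (auto simp: v_def w_def power_divide power_mult_distrib)
  define a where "a = (cmod (char (law 1) w))\<^sup>2"
  define b where "b = exp (- v)"
  define \<rho> where "\<rho> = L1.char_excess w"
  have \<rho>: "0 \<le> \<rho>"
    unfolding \<rho>_def by (rule L1.char_excess_nonneg[OF law_1_moments(2,1)])
  have "0 \<le> a" by (simp add: a_def)
  moreover have "a = 1 - v + \<rho>"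
    using L1.cmod_char_square[OF law_1_moments(2,1), of w]
    by (simp_all add: a_def \<rho>_def v_def law_1_moments(3))
  ultimately have a: "a = 1 - v + \<rho>" "0 \<le> a" by blast+
  have ab: "\<rho> - v\<^sup>2 / 2 \<le> a - b"
    using exp_minus_le_quadratic[OF v(2)] a by (simp add: b_def)
  have bn: "exp (- u\<^sup>2) \<le> b ^ n" "b ^ n \<le> 1"
  proof -
    have "v * real n \<le> v * t" using v(2) n by (intro mult_left_mono) auto
    then show "exp (- u\<^sup>2) \<le> b ^ n"
      unfolding b_def exp_of_nat_mult[symmetric] v(3) by (simp add: mult.commute)
    show "b ^ n \<le> 1" using v(2) by (intro power_le_one) (auto simp: b_def)
  qed
  have bk: "exp (- u\<^sup>2) - v \<le> b ^ Suc n"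
  proof -
    have "exp (- u\<^sup>2) * exp (- v) \<le> b ^ Suc n"
      using bn(1) by (simp add: b_def mult.commute mult_left_mono)
    moreover have "exp (- u\<^sup>2) * (1 - v) \<le> exp (- u\<^sup>2) * exp (- v)"
      using exp_ge_add_one_self[of "- v"] by (intro mult_left_mono) auto
    moreover have "exp (- u\<^sup>2) * v \<le> 1 * v"
      using v(2) by (intro mult_right_mono) auto
    ultimately show ?thesis by (simp add: right_diff_distrib)
  qed
  have "real (Suc n) * b ^ n * (\<rho> - v\<^sup>2 / 2) \<ge> t * exp (- u\<^sup>2) * \<rho> - t * v\<^sup>2"
  proof -
    have "t * exp (- u\<^sup>2) * \<rho> \<le> real (Suc n) * b ^ n * \<rho>"
      using t n bn \<rho> by (intro mult_mono) (auto simp: b_def)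
    moreover have "real (Suc n) * b ^ n * (v\<^sup>2 / 2) \<le> (2 * t) * 1 * (v\<^sup>2 / 2)"
      using t n bn by (intro mult_mono) (auto simp: b_def)
    ultimately show ?thesis by (simp add: right_diff_distrib)
  qed
  moreover have "real (Suc n) * b ^ n * (\<rho> - v\<^sup>2 / 2) \<le> real (Suc n) * b ^ n * (a - b)"
    using ab by (intro mult_left_mono) (auto simp: b_def)
  moreover have "b ^ Suc n + real (Suc n) * b ^ n * (a - b) \<le> a ^ Suc n"
    using Bernoulli_tangent_bound[OF a(2), of b "Suc n"] by (simp add: b_def)
  ultimately have "exp (- u\<^sup>2) - v + (t * exp (- u\<^sup>2) * \<rho> - t * v\<^sup>2) \<le> a ^ Suc n"
    using bk by linarith
  also have "a ^ Suc n \<le> (cmod (char (scaled_law t) u))\<^sup>2"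
  proof -
    have "char (scaled_law t) u = char (law t) w" using t by (simp add: char_scaled_law w_def)
    then have "char (scaled_law t) u = char (law 1) w ^ n * char (law s) w"
      by (subst (asm) n(4)) (simp add: char_law_of_nat_add[OF n(2)])
    then have "(cmod (char (scaled_law t) u))\<^sup>2 = a ^ n * (cmod (char (law s) w))\<^sup>2"
      by (simp add: a_def norm_mult norm_power power_mult_distrib power_mult[symmetric] mult.commute)
    moreover have "a \<le> (cmod (char (law s) w))\<^sup>2"
      unfolding a_def using cmod_char_law_1_le[OF n(2,3), of w] by (intro power_mono) auto
    ultimately show ?thesis
      using a(2) mult_left_mono[of a "(cmod (char (law s) w))\<^sup>2" "a ^ n"] by (simp add: mult.commute)
  qed
  moreover have "v + t * v\<^sup>2 = (u\<^sup>2 + u ^ 4) / t"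
    using t unfolding v(1) by (simp add: power_divide power2_eq_square power4_eq_xxxx add_divide_distrib)
  ultimately show ?thesis
    unfolding \<rho>_def w_def by (simp add: mult.assoc)
qed

definition gaussian_excess :: "real \<Rightarrow> real" where
  "gaussian_excess t = (\<integral>z. exp (- z\<^sup>2) * L1.char_excess (z / (\<sigma> * sqrt t)) \<partial>std_normal_distribution)"

lemma integrable_gaussian_excess:
  "integrable std_normal_distribution (\<lambda>z. exp (- z\<^sup>2) * L1.char_excess (z / (\<sigma> * sqrt t)))"
proof (rule Bochner_Integration.integrable_bound)
  note [measurable] = L1.borel_measurable_char_excess[OF law_1_moments(2,1)]
  show "(\<lambda>z. exp (- z\<^sup>2) * L1.char_excess (z / (\<sigma> * sqrt t))) \<in> borel_measurable std_normal_distribution"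
    by measurable
  show "integrable std_normal_distribution (\<lambda>z. (1 / (\<sigma> * sqrt t))\<^sup>2 * \<sigma>\<^sup>2 * z\<^sup>2)"
    using integrable_std_normal_distribution_moment[of 2] by simp
  show "AE z in std_normal_distribution. norm (exp (- z\<^sup>2) * L1.char_excess (z / (\<sigma> * sqrt t)))
      \<le> norm ((1 / (\<sigma> * sqrt t))\<^sup>2 * \<sigma>\<^sup>2 * z\<^sup>2)"
  proof (intro AE_I2)
    fix z :: real
    let ?w = "z / (\<sigma> * sqrt t)"
    have "(cmod (char (law 1) ?w))\<^sup>2 \<le> 1"
      by (simp add: power_le_one L1.cmod_char_le_1)
    then have "L1.char_excess ?w \<le> ?w\<^sup>2 * \<sigma>\<^sup>2"
      using L1.cmod_char_square[OF law_1_moments(2,1), of ?w] by (simp add: law_1_moments(3))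
    also have "?w\<^sup>2 * \<sigma>\<^sup>2 = (1 / (\<sigma> * sqrt t))\<^sup>2 * \<sigma>\<^sup>2 * z\<^sup>2"
      by (simp add: power_divide)
    finally have "exp (- z\<^sup>2) * L1.char_excess ?w \<le> 1 * ((1 / (\<sigma> * sqrt t))\<^sup>2 * \<sigma>\<^sup>2 * z\<^sup>2)"
      using L1.char_excess_nonneg[OF law_1_moments(2,1), of ?w] by (intro mult_mono) auto
    then show "norm (exp (- z\<^sup>2) * L1.char_excess ?w) \<le> norm ((1 / (\<sigma> * sqrt t))\<^sup>2 * \<sigma>\<^sup>2 * z\<^sup>2)"
      using L1.char_excess_nonneg[OF law_1_moments(2,1), of ?w] by (simp add: abs_mult)
  qed
qed

lemma gaussian_excess_le:
  assumes t: "1 \<le> t" and D: "\<And>x. \<bar>cdf (scaled_law t) x - cdf std_normal_distribution x\<bar> \<le> D"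
  shows "gaussian_excess t \<le> 6 * (D / t) + 4 / t\<^sup>2"
proof -
  interpret S: real_distribution "scaled_law t" using t by (intro real_distribution_scaled_law) simp
  interpret N: real_distribution std_normal_distribution by (rule real_dist_normal_dist)
  have m: "N.expectation (\<lambda>z. z\<^sup>2) = 1" "N.expectation (\<lambda>z. z ^ 4) = 3"
    using std_normal_distribution_even_moments(1)[of 1] std_normal_distribution_even_moments(1)[of 2]
    by (simp_all add: fact_numeral)
  note i = integrable_gaussian_excess[of t] integrable_std_normal_distribution_moment[of 2] integrable_std_normal_distribution_moment[of 4]
  have "t * gaussian_excess t - 4 / t
    = N.expectation (\<lambda>z. t * (exp (- z\<^sup>2) * L1.char_excess (z / (\<sigma> * sqrt t))) - (z\<^sup>2 + z ^ 4) / t)"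
    using i m by (simp add: gaussian_excess_def)
  also have "\<dots> \<le> N.expectation (\<lambda>z. (cmod (char (scaled_law t) z))\<^sup>2 - exp (- z\<^sup>2))"
  proof (rule integral_mono)
    show "integrable std_normal_distribution (\<lambda>z. t * (exp (- z\<^sup>2) * L1.char_excess (z / (\<sigma> * sqrt t))) - (z\<^sup>2 + z ^ 4) / t)"
      using i by simp
    have "(cmod (char (scaled_law t) z))\<^sup>2 \<le> 1" for z
      by (simp add: power_le_one S.cmod_char_le_1)
    then show "integrable std_normal_distribution (\<lambda>z. (cmod (char (scaled_law t) z))\<^sup>2 - exp (- z\<^sup>2))"
      by (intro Bochner_Integration.integrable_diff N.integrable_const_bound[where B=1]) auto
  qed (rule cmod_char_scaled_law_ge[OF t])
  also have "\<dots> \<le> 6 * D"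
    by (rule S.expectation_norm_char_sq_le[OF D])
  finally show ?thesis
    using t by (simp add: field_simps power2_eq_square)
qed

text \<open>
  Tonelli's theorem brings the integral over \<open>t\<close> inside, where \<open>nn_integral_cos_remainder_ge\<close> applies; it is
  enough to keep the values \<open>z\<close> in \<open>[1, 2]\<close> of the Gaussian variable, for which \<open>exp (- z\<^sup>2) \<ge> exp (- 4)\<close> and the
  argument \<open>z * y / \<sigma>\<close> is not smaller than \<open>y / \<sigma>\<close>.
\<close>

lemma nn_integral_gaussian_excess_ge:
  obtains c where "0 < c"
    "ennreal c * (\<integral>\<^sup>+y. ennreal (square_log (y / \<sigma>)) \<partial>symmetrization (law 1))
      \<le> (\<integral>\<^sup>+t. ennreal (gaussian_excess t) * indicator {1..} t \<partial>lborel)"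
proof -
  interpret S: real_distribution "symmetrization (law 1)" by (rule L1.real_distribution_symmetrization)
  interpret N: real_distribution std_normal_distribution by (rule real_dist_normal_dist)
  interpret SL: pair_sigma_finite "symmetrization (law 1)" lborel ..
  interpret NL: pair_sigma_finite std_normal_distribution lborel ..
  note [measurable] = L1.borel_measurable_char_excess[OF law_1_moments(2,1)]
  define p where "p = N.prob {1..2}"
  have "ennreal (std_normal_density 2) = (\<integral>\<^sup>+z. ennreal (std_normal_density 2) * indicator {1..2::real} z \<partial>lborel)"
    by (subst nn_integral_cmult_indicator) auto
  also have "\<dots> \<le> (\<integral>\<^sup>+z. ennreal (std_normal_density z) * indicator {1..2} z \<partial>lborel)"
  proof (rule nn_integral_mono)
    fix z :: real
    have "std_normal_density 2 \<le> std_normal_density z" if "1 \<le> z" "z \<le> 2"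
      using power_mono[of z 2 2] that by (simp add: std_normal_density_def divide_right_mono)
    then show "ennreal (std_normal_density 2) * indicator {1..2} z \<le> ennreal (std_normal_density z) * indicator {1..2} z"
      by (auto split: split_indicator intro: ennreal_leI)
  qed
  also have "\<dots> = ennreal p"
    by (simp add: p_def emeasure_density flip: N.emeasure_eq_measure)
  finally have "0 < p" by (metis ennreal_le_iff2 normal_density_pos less_le_trans zero_less_one less_irrefl not_le)
  show ?thesis
  proof (rule that[of "exp (- 4) * p"])
    show "0 < exp (- 4) * p" using \<open>0 < p\<close> by simp
    let ?r = "\<lambda>t z y. ennreal (exp (- z\<^sup>2)) * (ennreal (cos_remainder (z / (\<sigma> * sqrt t) * y)) * indicator {1..} t)"
    have "ennreal (exp (- 4) * p) * (\<integral>\<^sup>+y. ennreal (square_log (y / \<sigma>)) \<partial>symmetrization (law 1))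
      = (\<integral>\<^sup>+z. (\<integral>\<^sup>+y. ennreal (exp (- 4)) * ennreal (square_log (y / \<sigma>)) \<partial>symmetrization (law 1)) * indicator {1..2} z \<partial>std_normal_distribution)"
    proof -
      have "(\<integral>\<^sup>+y. ennreal (exp (- 4)) * ennreal (square_log (y / \<sigma>)) \<partial>symmetrization (law 1))
         = ennreal (exp (- 4)) * (\<integral>\<^sup>+y. ennreal (square_log (y / \<sigma>)) \<partial>symmetrization (law 1))"
        by (rule nn_integral_cmult) simp
      moreover have "ennreal (exp (- 4) * p) = ennreal (exp (- 4)) * emeasure std_normal_distribution {1..2}"
        using \<open>0 < p\<close> by (simp only: p_def N.emeasure_eq_measure) (rule ennreal_mult; simp)
      ultimately show ?thesis
        by (subst nn_integral_cmult_indicator) (simp_all only: mult_ac, simp)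
    qed
    also have "\<dots> \<le> (\<integral>\<^sup>+z. \<integral>\<^sup>+y. \<integral>\<^sup>+t. ?r t z y \<partial>lborel \<partial>symmetrization (law 1) \<partial>std_normal_distribution)"
    proof (rule nn_integral_mono)
      fix z :: real
      show "(\<integral>\<^sup>+y. ennreal (exp (- 4)) * ennreal (square_log (y / \<sigma>)) \<partial>symmetrization (law 1)) * indicator {1..2} z
         \<le> (\<integral>\<^sup>+y. \<integral>\<^sup>+t. ?r t z y \<partial>lborel \<partial>symmetrization (law 1))"
      proof (cases "z \<in> {1..2}")
        case True
        then have z2: "z\<^sup>2 \<le> 4" using power_mono[of z 2 2] by simp
        have "ennreal (exp (- 4)) * ennreal (square_log (y / \<sigma>)) \<le> (\<integral>\<^sup>+t. ?r t z y \<partial>lborel)" for y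
        proof -
          have "\<bar>y / \<sigma>\<bar> * 1 \<le> \<bar>y / \<sigma>\<bar> * \<bar>z\<bar>"
            using True by (intro mult_left_mono) auto
          then have "square_log (y / \<sigma>) \<le> square_log (z * y / \<sigma>)"
            by (intro square_log_mono) (simp add: abs_mult abs_divide mult.commute)
          then have "ennreal (square_log (y / \<sigma>)) \<le> (\<integral>\<^sup>+t. ennreal (cos_remainder (z * y / \<sigma> / sqrt t)) * indicator {1..} t \<partial>lborel)"
            by (intro order_trans[OF ennreal_leI nn_integral_cos_remainder_ge])
          also have "\<dots> = (\<integral>\<^sup>+t. ennreal (cos_remainder (z / (\<sigma> * sqrt t) * y)) * indicator {1..} t \<partial>lborel)"
            by (simp add: field_simps)
          finally have "ennreal (exp (- 4)) * ennreal (square_log (y / \<sigma>))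
            \<le> ennreal (exp (- z\<^sup>2)) * \<dots>"
            using z2 by (intro mult_mono ennreal_leI) auto
          also have "\<dots> = (\<integral>\<^sup>+t. ?r t z y \<partial>lborel)"
            by (rule nn_integral_cmult[symmetric]) simp
          finally show ?thesis .
        qed
        then show ?thesis using True by (auto intro!: nn_integral_mono)
      qed simp
    qed
    also have "\<dots> = (\<integral>\<^sup>+z. \<integral>\<^sup>+t. \<integral>\<^sup>+y. ?r t z y \<partial>symmetrization (law 1) \<partial>lborel \<partial>std_normal_distribution)"
      by (intro nn_integral_cong SL.Fubini'[symmetric]) simp
    also have "\<dots> = (\<integral>\<^sup>+z. \<integral>\<^sup>+t. ennreal (exp (- z\<^sup>2) * L1.char_excess (z / (\<sigma> * sqrt t))) * indicator {1..} t \<partial>lborel \<partial>std_normal_distribution)"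
    proof (intro nn_integral_cong)
      fix z t :: real
      let ?w = "z / (\<sigma> * sqrt t)"
      have "(\<integral>\<^sup>+y. ennreal (cos_remainder (?w * y)) \<partial>symmetrization (law 1)) = ennreal (L1.char_excess ?w)"
        unfolding L1.char_excess_def
        using L1.integrable_cos_remainder_symmetrization[OF law_1_moments(2,1), of ?w] cos_remainder_nonneg
        by (intro nn_integral_eq_integral) auto
      then show "(\<integral>\<^sup>+y. ?r t z y \<partial>symmetrization (law 1)) = ennreal (exp (- z\<^sup>2) * L1.char_excess ?w) * indicator {1..} t"
        by (simp add: nn_integral_cmult nn_integral_multc ennreal_mult' mult.assoc)
    qed
    also have "\<dots> = (\<integral>\<^sup>+t. \<integral>\<^sup>+z. ennreal (exp (- z\<^sup>2) * L1.char_excess (z / (\<sigma> * sqrt t))) * indicator {1..} t \<partial>std_normal_distribution \<partial>lborel)"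
      by (rule NL.Fubini'[symmetric]) simp
    also have "\<dots> = (\<integral>\<^sup>+t. ennreal (gaussian_excess t) * indicator {1..} t \<partial>lborel)"
    proof (intro nn_integral_cong)
      fix t :: real
      show "(\<integral>\<^sup>+z. ennreal (exp (- z\<^sup>2) * L1.char_excess (z / (\<sigma> * sqrt t))) * indicator {1..} t \<partial>std_normal_distribution)
         = ennreal (gaussian_excess t) * indicator {1..} t"
        unfolding gaussian_excess_def
        using integrable_gaussian_excess[of t] L1.char_excess_nonneg[OF law_1_moments(2,1)]
        by (subst nn_integral_multc) (auto simp: nn_integral_eq_integral)
    qed
    finally show "ennreal (exp (- 4) * p) * (\<integral>\<^sup>+y. ennreal (square_log (y / \<sigma>)) \<partial>symmetrization (law 1))
      \<le> (\<integral>\<^sup>+t. ennreal (gaussian_excess t) * indicator {1..} t \<partial>lborel)" .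
  qed
qed

text \<open>
  The excess is at most \<open>6 * D / t + 4 / t\<^sup>2\<close>, where \<open>D\<close> is the Kolmogorov distance. The integrand of the hypothesis is not
  known to be measurable in \<open>t\<close>, and the integral of such a function is a lower integral, which is monotone but not
  additive. Therefore the measurable function \<open>4 / t\<^sup>2\<close> is first subtracted from the excess.
\<close>

lemma log_moment_finite:
  assumes H: "(\<integral>\<^sup>+t\<in>{1..}. (SUP x. ennreal \<bar>prob {\<omega> \<in> space M. X t \<omega> / sqrt t \<le> x} - std_normal_cdf (x / \<sigma>)\<bar>) / ennreal t \<partial>lborel) < \<infinity>"
  shows "(\<integral>\<^sup>+\<omega>. ennreal ((X 1 \<omega>)\<^sup>2 * max 0 (ln \<bar>X 1 \<omega>\<bar>)) \<partial>M) < \<infinity>"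
proof -
  interpret N: real_distribution std_normal_distribution by (rule real_dist_normal_dist)
  interpret P: pair_prob_space "law 1" "law 1" ..
  have [measurable]: "gaussian_excess \<in> borel_measurable borel"
  proof -
    note [measurable] = L1.borel_measurable_char_excess[OF law_1_moments(2,1)]
    show ?thesis unfolding gaussian_excess_def by measurable
  qed
  let ?S = "\<lambda>t. SUP x. ennreal \<bar>prob {\<omega> \<in> space M. X t \<omega> / sqrt t \<le> x} - std_normal_cdf (x / \<sigma>)\<bar>"
  define g where "g t = max 0 (gaussian_excess t - 4 / t\<^sup>2) / 6" for t
  have g_le: "ennreal (g t) \<le> ?S t / ennreal t" if t: "1 \<le> t" for t
  proof -
    interpret S: real_distribution "scaled_law t" using t by (intro real_distribution_scaled_law) simp
    have S_eq: "?S t = (SUP x. ennreal \<bar>cdf (scaled_law t) (x / \<sigma>) - cdf std_normal_distribution (x / \<sigma>)\<bar>)"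
      using t by (simp add: prob_eq_cdf_scaled_law std_normal_cdf_eq_cdf)
    have "\<bar>cdf (scaled_law t) x - cdf std_normal_distribution x\<bar> \<le> 1" for x
      using S.cdf_bounded_prob[of x] S.cdf_nonneg[of x] N.cdf_bounded_prob[of x] N.cdf_nonneg[of x] by linarith
    then have "?S t \<le> ennreal 1"
      unfolding S_eq by (intro SUP_least ennreal_leI)
    then obtain D where D: "?S t = ennreal D" "0 \<le> D"
      by (cases "?S t") (auto simp: top_unique)
    have "\<bar>cdf (scaled_law t) x - cdf std_normal_distribution x\<bar> \<le> D" for x
    proof -
      have "ennreal \<bar>cdf (scaled_law t) (\<sigma> * x / \<sigma>) - cdf std_normal_distribution (\<sigma> * x / \<sigma>)\<bar> \<le> ?S t"
        unfolding S_eq by (rule SUP_upper) simp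
      then show ?thesis using D sigma_pos by simp
    qed
    from gaussian_excess_le[OF t this] have "gaussian_excess t - 4 / t\<^sup>2 \<le> 6 * (D / t)" by linarith
    moreover have "0 \<le> 6 * (D / t)" using t D(2) by simp
    ultimately have "max 0 (gaussian_excess t - 4 / t\<^sup>2) \<le> D / t * 6"
      by (simp only: max.bounded_iff mult.commute[of "D / t"])
    then have "g t \<le> D / t" unfolding g_def by (subst pos_divide_le_eq) simp_all
    then have "ennreal (g t) \<le> ennreal (D / t)" by (rule ennreal_leI)
    also have "\<dots> = ?S t / ennreal t"
      using t D by (simp add: divide_ennreal)
    finally show ?thesis .
  qed
  have "(\<integral>\<^sup>+t. ennreal (gaussian_excess t) * indicator {1..} t \<partial>lborel)
     \<le> (\<integral>\<^sup>+t. 6 * (ennreal (g t) * indicator {1..} t) + ennreal (4 / t\<^sup>2) * indicator {1..} t \<partial>lborel)"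
  proof (rule nn_integral_mono)
    fix t :: real
    have "gaussian_excess t \<le> 6 * g t + 4 / t\<^sup>2" "0 \<le> g t" by (auto simp: g_def)
    then have "ennreal (gaussian_excess t) \<le> 6 * ennreal (g t) + ennreal (4 / t\<^sup>2)"
      by (metis ennreal_leI ennreal_mult' ennreal_numeral ennreal_plus mult_nonneg_nonneg zero_le_divide_iff zero_le_numeral zero_le_power2)
    then show "ennreal (gaussian_excess t) * indicator {1..} t
       \<le> 6 * (ennreal (g t) * indicator {1..} t) + ennreal (4 / t\<^sup>2) * indicator {1..} t"
      by (auto split: split_indicator)
  qed
  also have "\<dots> = 6 * (\<integral>\<^sup>+t. ennreal (g t) * indicator {1..} t \<partial>lborel) + (\<integral>\<^sup>+t. ennreal (4 / t\<^sup>2) * indicator {1..} t \<partial>lborel)"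
    unfolding g_def by (subst nn_integral_add) (auto simp: nn_integral_cmult)
  also have "(\<integral>\<^sup>+t. ennreal (4 / t\<^sup>2) * indicator {1..} t \<partial>lborel) = ennreal (0 - (- 4 / 1))"
  proof (rule nn_integral_FTC_atLeast)
    show "((\<lambda>t::real. - 4 / t) \<longlongrightarrow> 0) at_top"
      by (intro tendsto_divide_0[OF tendsto_const] filterlim_at_top_imp_at_infinity filterlim_ident)
  qed (auto intro!: derivative_eq_intros simp: power2_eq_square)
  finally have J: "(\<integral>\<^sup>+t. ennreal (gaussian_excess t) * indicator {1..} t \<partial>lborel)
     \<le> 6 * (\<integral>\<^sup>+t. ennreal (g t) * indicator {1..} t \<partial>lborel) + ennreal (0 - (- 4 / 1))" .
  have "(\<integral>\<^sup>+t. ennreal (g t) * indicator {1..} t \<partial>lborel) \<le> (\<integral>\<^sup>+t\<in>{1..}. ?S t / ennreal t \<partial>lborel)"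
    using g_le by (intro nn_integral_mono) (auto split: split_indicator)
  then have "(\<integral>\<^sup>+t. ennreal (g t) * indicator {1..} t \<partial>lborel) < \<infinity>"
    using H by (rule le_less_trans)
  then have "6 * (\<integral>\<^sup>+t. ennreal (g t) * indicator {1..} t \<partial>lborel) + ennreal (0 - (- 4 / 1)) < \<infinity>"
    by (simp add: ennreal_mult_less_top)
  with J have J_fin: "(\<integral>\<^sup>+t. ennreal (gaussian_excess t) * indicator {1..} t \<partial>lborel) < \<infinity>"
    by (rule le_less_trans)
  obtain c where c: "0 < c" "ennreal c * (\<integral>\<^sup>+y. ennreal (square_log (y / \<sigma>)) \<partial>symmetrization (law 1))
      \<le> (\<integral>\<^sup>+t. ennreal (gaussian_excess t) * indicator {1..} t \<partial>lborel)"
    by (rule nn_integral_gaussian_excess_ge)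
  from c(2) J_fin have "ennreal c * (\<integral>\<^sup>+y. ennreal (square_log (y / \<sigma>)) \<partial>symmetrization (law 1)) < \<infinity>"
    by (rule le_less_trans)
  then have "(\<integral>\<^sup>+y. ennreal (square_log (y / \<sigma>)) \<partial>symmetrization (law 1)) < \<infinity>"
    using c(1) by (auto simp: ennreal_mult_less_top)
  also have "(\<integral>\<^sup>+y. ennreal (square_log (y / \<sigma>)) \<partial>symmetrization (law 1))
     = (\<integral>\<^sup>+p. ennreal (square_log ((fst p - snd p) / \<sigma>)) \<partial>(law 1 \<Otimes>\<^sub>M law 1))"
    unfolding symmetrization_def by (subst nn_integral_distr) (auto simp: split_beta)
  also have "\<dots> = (\<integral>\<^sup>+a. \<integral>\<^sup>+x. ennreal (square_log ((a - x) / \<sigma>)) \<partial>law 1 \<partial>law 1)"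
    by (subst L1.nn_integral_fst[symmetric]) auto
  finally have fin: "(\<integral>\<^sup>+a. \<integral>\<^sup>+x. ennreal (square_log ((a - x) / \<sigma>)) \<partial>law 1 \<partial>law 1) < \<infinity>" .
  \<comment> \<open>a value of the independent copy for which the section of the double integral is finite\<close>
  obtain a where a: "(\<integral>\<^sup>+x. ennreal (square_log ((a - x) / \<sigma>)) \<partial>law 1) < \<infinity>"
  proof (rule ccontr)
    assume "\<not> thesis"
    then have "(\<integral>\<^sup>+x. ennreal (square_log ((a - x) / \<sigma>)) \<partial>law 1) = \<infinity>" for a
      using that by (auto simp: less_top[symmetric])
    then show False using fin by (simp add: L1.emeasure_space_1[simplified])
  qed
  define T where "T = max (2 * \<bar>a\<bar>) (32 * \<sigma>\<^sup>2)"
  have "(\<integral>\<^sup>+\<omega>. ennreal ((X 1 \<omega>)\<^sup>2 * max 0 (ln \<bar>X 1 \<omega>\<bar>)) \<partial>M) = (\<integral>\<^sup>+x. ennreal (x\<^sup>2 * max 0 (ln \<bar>x\<bar>)) \<partial>law 1)"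
    using random_variable[of 1] by (simp add: nn_integral_distr)
  also have "\<dots> \<le> (\<integral>\<^sup>+x. ennreal (T\<^sup>2 * max 0 (ln T)) + ennreal (16 * \<sigma>\<^sup>2) * ennreal (square_log ((a - x) / \<sigma>)) \<partial>law 1)"
  proof (rule nn_integral_mono)
    fix x :: real
    have "ennreal (x\<^sup>2 * max 0 (ln \<bar>x\<bar>)) \<le> ennreal (T\<^sup>2 * max 0 (ln T) + 16 * \<sigma>\<^sup>2 * square_log ((a - x) / \<sigma>))"
      unfolding T_def using sigma_pos by (intro ennreal_leI square_mult_ln_le_square_log)
    also have "\<dots> = ennreal (T\<^sup>2 * max 0 (ln T)) + ennreal (16 * \<sigma>\<^sup>2) * ennreal (square_log ((a - x) / \<sigma>))"
      by (subst ennreal_plus) (auto simp: ennreal_mult square_log_nonneg)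
    finally show "ennreal (x\<^sup>2 * max 0 (ln \<bar>x\<bar>)) \<le> \<dots>" .
  qed
  also have "\<dots> = ennreal (T\<^sup>2 * max 0 (ln T)) + ennreal (16 * \<sigma>\<^sup>2) * (\<integral>\<^sup>+x. ennreal (square_log ((a - x) / \<sigma>)) \<partial>law 1)"
    by (subst nn_integral_add) (auto simp: nn_integral_cmult L1.emeasure_space_1[simplified])
  also have "\<dots> < \<infinity>"
    using a by (simp add: ennreal_mult_less_top)
  finally show ?thesis .
qed

end

theorem theorem1p2:
  fixes M :: "'a measure" and X :: "real \<Rightarrow> 'a \<Rightarrow> real" and \<sigma> :: real
  assumes levy: "levy_process M X"
    and integrable: "integrable M (X 1)"
    and mean_zero: "(\<integral>\<omega>. X 1 \<omega> \<partial>M) = 0"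
    and square_integrable: "integrable M (\<lambda>\<omega>. (X 1 \<omega>)\<^sup>2)"
    and sigma: "\<sigma> = sqrt (\<integral>\<omega>. (X 1 \<omega>)\<^sup>2 \<partial>M)"
    and sigma_pos: "0 < \<sigma>"
  shows "(\<integral>\<^sup>+t\<in>{1..}. (SUP x. ennreal \<bar>measure M {\<omega> \<in> space M. X t \<omega> / sqrt t \<le> x}
                                    - std_normal_cdf (x / \<sigma>)\<bar>) / ennreal t \<partial>lborel) < \<infinity>
     \<longleftrightarrow> (\<integral>\<^sup>+\<omega>. ennreal ((X 1 \<omega>)\<^sup>2 * max 0 (ln \<bar>X 1 \<omega>\<bar>)) \<partial>M) < \<infinity>"
proof -
  interpret levy_process M X by (rule levy)
  interpret centered_levy_process M X \<sigma>
    by unfold_locales (use assms in \<open>auto simp: integral_nonneg_AE\<close>)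
  show ?thesis
    using log_moment_finite Kolmogorov_distance_integrable by (rule iffI)
qed

end
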